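(* Let $\mathcal{E}_*$ be a Hilbert space, let $A \in \mathcal{B}(\mathcal{E}_* )$ with $w(A) \leq 1$, and let $\mathcal{S} \neq \{0\}$ be a closed subspace of $H^2_{\mathcal{E}_*}(\mathbb{D})$. Then $\mathcal{S}$ is invariant under both $M_{A+A^*z}$ and $M_z$ if and only if $$(A + A^* M_z) M_{\Theta} = M_{\Theta} (B + B^* M_z)$$ for some operator $B \in \mathcal{B}(\mathcal{E})$ with $w(B) \leq 1$, where $\mathcal{S} = M_{\Theta} H^2_{\mathcal{E}}(\mathbb{D})$ is the Beurling-Lax-Halmos representation of $\mathcal{S}$ (with $\mathcal{E}$ a Hilbert space and $\Theta \in H^\infty_{\mathcal{B}(\mathcal{E},\mathcal{E}_* )}(\mathbb{D})$ inner). Moreover, when such an operator $B$ exists it is unique (up to unitary equivalence).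
   Context: All Hilbert spaces are complex and separable. $\mathbb{D}$ is the open unit disc, $H^2_{\mathcal{E}}(\mathbb{D})$ is the $\mathcal{E}$-valued Hardy space, identified with $H^2(\mathbb{D})\otimes\mathcal{E}$, and $M_z$ is multiplication by the coordinate function. For $A\in\mathcal{B}(\mathcal{E})$, $A + A^*M_z = M_{A+A^*z}$ denotes $I_{H^2(\mathbb{D})}\otimes A + M_z\otimes A^*$, i.e. multiplication by the operator-valued polynomial $z\mapsto A+A^*z$. The numerical radius is $w(A)=\sup\{|\langle Ah,h\rangle| : \|h\|\leq 1\}$. A function $\Theta \in H^\infty_{\mathcal{B}(\mathcal{E},\mathcal{E}_* )}(\mathbb{D})$ is inner if its boundary values are isometries almost everywhere on the circle (equivalently, $M_\Theta: H^2_{\mathcal{E}}(\mathbb{D})\to H^2_{\mathcal{E}_*}(\mathbb{D})$ is an isometry). By the Beurling-Lax-Halmos theorem, a nonzero closed subspace $\mathcal{S}$ of $H^2_{\mathcal{E}_*}(\mathbb{D})$ is $M_z$-invariant if and only if $\mathcal{S}=M_\Theta H^2_{\mathcal{E}}(\mathbb{D})$ for some Hilbert space $\mathcal{E}$ and inner $\Theta\in H^\infty_{\mathcal{B}(\mathcal{E},\mathcal{E}_* )}(\mathbb{D})$; the pair $\{\mathcal{E},\Theta\}$ is unique up to a constant unitary factor, and $\mathcal{S}=M_\Theta H^2_{\mathcal{E}}(\mathbb{D})$ is called the Beurling-Lax-Halmos representation of $\mathcal{S}$. *)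

theory Defs
  imports "HOL-Analysis.Analysis"
begin

section \<open>Complex inner product spaces\<close>

class complex_inner = real_inner +
  fixes scaleC :: "complex \<Rightarrow> 'a \<Rightarrow> 'a"  (infixr \<open>*\<^sub>C\<close> 75)
    and cinner :: "'a \<Rightarrow> 'a \<Rightarrow> complex"
  assumes scaleC_add_right: "a *\<^sub>C (x + y) = a *\<^sub>C x + a *\<^sub>C y"
    and scaleC_add_left: "(a + b) *\<^sub>C x = a *\<^sub>C x + b *\<^sub>C x"
    and scaleC_scaleC: "a *\<^sub>C b *\<^sub>C x = (a * b) *\<^sub>C x"
    and scaleC_of_real: "complex_of_real r *\<^sub>C x = r *\<^sub>R x"
    and cinner_commute: "cinner x y = cnj (cinner y x)"
    and cinner_add_left: "cinner (x + y) z = cinner x z + cinner y z"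
    and cinner_scaleC_left: "cinner (a *\<^sub>C x) y = a * cinner x y"
    and inner_eq_Re_cinner: "inner x y = Re (cinner x y)"

text \<open>
  The inner product \<^term>\<open>cinner\<close> is linear in its first argument.  Norm and topology are those of
  \<^class>\<open>real_inner\<close>, whose real inner product is the real part of \<^term>\<open>cinner\<close>.
  A separable complex Hilbert space is a type of sort
  \<^class>\<open>complex_inner\<close> together with \<^class>\<open>polish_space\<close>, or a closed subspace of such a type.
\<close>

lemma scaleC_one: "1 *\<^sub>C x = (x :: 'a::complex_inner)"
  using scaleC_of_real[of 1 x] by simp

interpretation complex_vector: vector_space "scaleC :: complex \<Rightarrow> 'a \<Rightarrow> 'a::complex_inner"
  by standard (simp_all add: scaleC_add_right scaleC_add_left scaleC_scaleC scaleC_one)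

abbreviation csubspace :: "'a::complex_inner set \<Rightarrow> bool"
  where "csubspace \<equiv> complex_vector.subspace"

lemma cinner_self: "cinner x x = complex_of_real ((norm x)\<^sup>2)"
proof (rule complex_eqI)
  show "Re (cinner x x) = Re (complex_of_real ((norm x)\<^sup>2))"
    by (simp add: inner_eq_Re_cinner[symmetric] power2_norm_eq_inner)
  show "Im (cinner x x) = Im (complex_of_real ((norm x)\<^sup>2))"
    using arg_cong[OF cinner_commute[of x x], of Im] by simp
qed

lemma norm_scaleC: "norm (a *\<^sub>C x) = cmod a * norm (x :: 'a::complex_inner)"
proof -
  have "cinner (a *\<^sub>C x) (a *\<^sub>C x) = a * cnj (cinner (a *\<^sub>C x) x)"
    by (simp add: cinner_scaleC_left cinner_commute[of x "a *\<^sub>C x"])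
  also have "\<dots> = a * cnj a * cnj (cinner x x)"
    by (simp add: cinner_scaleC_left)
  also have "\<dots> = complex_of_real ((cmod a * norm x)\<^sup>2)"
    by (simp add: cinner_self complex_norm_square[symmetric] power_mult_distrib)
  finally have "complex_of_real ((norm (a *\<^sub>C x))\<^sup>2) = complex_of_real ((cmod a * norm x)\<^sup>2)"
    by (simp only: cinner_self)
  then have "(norm (a *\<^sub>C x))\<^sup>2 = (cmod a * norm x)\<^sup>2"
    by (simp only: of_real_eq_iff)
  then show ?thesis by (simp add: power2_eq_iff_nonneg)
qed

lemma cinner_zero_left [simp]: "cinner 0 x = 0"
  using cinner_add_left[of 0 0 x] by simp

lemma cmod_cinner_le: "cmod (cinner x y) \<le> norm x * norm (y :: 'a::complex_inner)"
proof (cases "cinner x y = 0")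
  case False
  define a where "a = cnj (cinner x y) / cmod (cinner x y)"
  have a: "cmod a = 1" using False by (simp add: a_def norm_divide)
  have "cinner (a *\<^sub>C x) y = cmod (cinner x y)"
    using False complex_norm_square[of "cinner x y"]
    by (simp add: cinner_scaleC_left a_def field_simps power2_eq_square)
  then have "cmod (cinner x y) = inner (a *\<^sub>C x) y"
    by (simp add: inner_eq_Re_cinner)
  also have "\<dots> \<le> norm (a *\<^sub>C x) * norm y" by (rule norm_cauchy_schwarz)
  finally show ?thesis using a by (simp add: norm_scaleC)
qed simp

instantiation complex :: complex_inner
begin
definition scaleC_complex :: "complex \<Rightarrow> complex \<Rightarrow> complex"
  where "scaleC_complex a x = a * x"
definition cinner_complex :: "complex \<Rightarrow> complex \<Rightarrow> complex"
  where "cinner_complex x y = x * cnj y"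
instance
  by standard (simp_all add: scaleC_complex_def cinner_complex_def inner_complex_def algebra_simps
      scaleR_conv_of_real)
end


section \<open>The vector-valued Hardy space\<close>

text \<open>
  A function in the Hardy space over the unit disc is represented by the sequence of its Taylor
  coefficients, which ranges over all norm-square-summable sequences; \<^term>\<open>h2_eval f z\<close> below is
  its value at a point \<open>z\<close> of the disc.
\<close>

typedef (overloaded) 'a h2 = "{f :: nat \<Rightarrow> 'a::complex_inner. summable (\<lambda>n. (norm (f n))\<^sup>2)}"
  morphisms h2_coeff Abs_h2
  by (rule exI[of _ "\<lambda>_. 0"]) simp

setup_lifting type_definition_h2

lemma h2_add_summable:
  fixes f g :: "nat \<Rightarrow> 'a::real_inner"
  assumes "summable (\<lambda>n. (norm (f n))\<^sup>2)" "summable (\<lambda>n. (norm (g n))\<^sup>2)"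
  shows "summable (\<lambda>n. (norm (f n + g n))\<^sup>2)"
proof (rule summable_comparison_test')
  show "summable (\<lambda>n. 2 * (norm (f n))\<^sup>2 + 2 * (norm (g n))\<^sup>2)"
    using assms by (intro summable_add summable_mult)
  show "norm ((norm (f n + g n))\<^sup>2) \<le> 2 * (norm (f n))\<^sup>2 + 2 * (norm (g n))\<^sup>2" for n
  proof -
    have "(norm (f n + g n))\<^sup>2 \<le> (norm (f n) + norm (g n))\<^sup>2"
      by (intro power_mono norm_triangle_ineq) simp
    also have "\<dots> \<le> 2 * (norm (f n))\<^sup>2 + 2 * (norm (g n))\<^sup>2"
      using zero_le_power2[of "norm (f n) - norm (g n)"] by (simp add: power2_eq_square algebra_simps)
    finally show ?thesis by simp
  qed
qed

lemma h2_cinner_summable: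
  fixes f g :: "nat \<Rightarrow> 'a::complex_inner"
  assumes "summable (\<lambda>n. (norm (f n))\<^sup>2)" "summable (\<lambda>n. (norm (g n))\<^sup>2)"
  shows "summable (\<lambda>n. cinner (f n) (g n))"
proof (rule summable_comparison_test')
  show "summable (\<lambda>n. (norm (f n))\<^sup>2 + (norm (g n))\<^sup>2)"
    using assms by (intro summable_add)
  show "cmod (cinner (f n) (g n)) \<le> (norm (f n))\<^sup>2 + (norm (g n))\<^sup>2" for n
  proof -
    have "cmod (cinner (f n) (g n)) \<le> norm (f n) * norm (g n)" by (rule cmod_cinner_le)
    also have "\<dots> \<le> (norm (f n))\<^sup>2 + (norm (g n))\<^sup>2"
      using sum_squares_bound[of "norm (f n)" "norm (g n)"]
        mult_nonneg_nonneg[OF norm_ge_zero norm_ge_zero, of "f n" "g n"] by linarith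
    finally show ?thesis .
  qed
qed

instantiation h2 :: (complex_inner) complex_inner
begin

lift_definition zero_h2 :: "'a h2" is "\<lambda>_. 0" by simp
lift_definition plus_h2 :: "'a h2 \<Rightarrow> 'a h2 \<Rightarrow> 'a h2" is "\<lambda>f g n. f n + g n"
  by (rule h2_add_summable)
lift_definition uminus_h2 :: "'a h2 \<Rightarrow> 'a h2" is "\<lambda>f n. - f n" by simp
lift_definition minus_h2 :: "'a h2 \<Rightarrow> 'a h2 \<Rightarrow> 'a h2" is "\<lambda>f g n. f n - g n"
proof -
  fix f g :: "nat \<Rightarrow> 'a"
  assume "summable (\<lambda>n. (norm (f n))\<^sup>2)" "summable (\<lambda>n. (norm (g n))\<^sup>2)"
  then show "summable (\<lambda>n. (norm (f n - g n))\<^sup>2)"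
    using h2_add_summable[of f "\<lambda>n. - g n"] by simp
qed
lift_definition scaleR_h2 :: "real \<Rightarrow> 'a h2 \<Rightarrow> 'a h2" is "\<lambda>r f n. r *\<^sub>R f n"
  by (simp add: power_mult_distrib summable_mult)
lift_definition scaleC_h2 :: "complex \<Rightarrow> 'a h2 \<Rightarrow> 'a h2" is "\<lambda>a f n. a *\<^sub>C f n"
  by (simp add: norm_scaleC power_mult_distrib summable_mult)
lift_definition cinner_h2 :: "'a h2 \<Rightarrow> 'a h2 \<Rightarrow> complex"
  is "\<lambda>f g. \<Sum>n. cinner (f n) (g n)" .

definition inner_h2 :: "'a h2 \<Rightarrow> 'a h2 \<Rightarrow> real"
  where "inner_h2 f g = Re (cinner f g)"
definition norm_h2 :: "'a h2 \<Rightarrow> real"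
  where "norm_h2 f = sqrt (inner f f)"
definition sgn_h2 :: "'a h2 \<Rightarrow> 'a h2"
  where "sgn_h2 f = inverse (norm f) *\<^sub>R f"
definition dist_h2 :: "'a h2 \<Rightarrow> 'a h2 \<Rightarrow> real"
  where "dist_h2 f g = norm (f - g)"
definition uniformity_h2 :: "('a h2 \<times> 'a h2) filter"
  where "uniformity_h2 = (INF e\<in>{0<..}. principal {(f, g). dist f g < e})"
definition open_h2 :: "'a h2 set \<Rightarrow> bool"
  where "open_h2 U \<longleftrightarrow> (\<forall>f\<in>U. eventually (\<lambda>(f', g). f' = f \<longrightarrow> g \<in> U) uniformity)"

instance
proof
  fix f g h :: "'a h2" and a b :: complex and r s :: real
  show "f + g + h = f + (g + h)" by transfer (simp add: add.assoc)
  show "f + g = g + f" by transfer (simp add: add.commute)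
  show "0 + f = f" by transfer simp
  show "- f + f = 0" by transfer simp
  show "f - g = f + - g" by transfer simp
  show "r *\<^sub>R (f + g) = r *\<^sub>R f + r *\<^sub>R g" by transfer (simp add: scaleR_add_right)
  show "(r + s) *\<^sub>R f = r *\<^sub>R f + s *\<^sub>R f" by transfer (simp add: scaleR_add_left)
  show "r *\<^sub>R s *\<^sub>R f = (r * s) *\<^sub>R f" by transfer simp
  show "1 *\<^sub>R f = f" by transfer simp
  show "a *\<^sub>C (f + g) = a *\<^sub>C f + a *\<^sub>C g" by transfer (simp add: scaleC_add_right)
  show "(a + b) *\<^sub>C f = a *\<^sub>C f + b *\<^sub>C f" by transfer (simp add: scaleC_add_left)
  show "a *\<^sub>C b *\<^sub>C f = (a * b) *\<^sub>C f" by transfer (simp add: scaleC_scaleC)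
  show scR: "complex_of_real r *\<^sub>C f = r *\<^sub>R f" for r and f :: "'a h2" by transfer (simp add: scaleC_of_real)
  show comm: "cinner f g = cnj (cinner g f)" for f g :: "'a h2"
  proof transfer
    fix f g :: "nat \<Rightarrow> 'a"
    assume fg: "summable (\<lambda>n. (norm (f n))\<^sup>2)" "summable (\<lambda>n. (norm (g n))\<^sup>2)"
    have "(\<lambda>n. cnj (cinner (g n) (f n))) sums cnj (\<Sum>n. cinner (g n) (f n))"
      using summable_sums[OF h2_cinner_summable[OF fg(2,1)]] by (simp add: sums_cnj)
    moreover have "(\<lambda>n. cnj (cinner (g n) (f n))) = (\<lambda>n. cinner (f n) (g n))"
      by (rule ext) (rule cinner_commute[symmetric])
    ultimately show "(\<Sum>n. cinner (f n) (g n)) = cnj (\<Sum>n. cinner (g n) (f n))"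
      by (simp add: sums_iff)
  qed
  show add: "cinner (f + g) h = cinner f h + cinner g h" for f g h :: "'a h2"
    by transfer (simp add: cinner_add_left suminf_add h2_cinner_summable)
  show scale: "cinner (a *\<^sub>C f) g = a * cinner f g" for a and f g :: "'a h2"
    by transfer (simp add: cinner_scaleC_left suminf_mult h2_cinner_summable)
  show "inner f g = Re (cinner f g)" by (simp add: inner_h2_def)
  show "inner f g = inner g f" by (simp add: inner_h2_def comm[of f g])
  show "inner (f + g) h = inner f h + inner g h" by (simp add: inner_h2_def add)
  show "inner (r *\<^sub>R f) g = r * inner f g" by (simp add: inner_h2_def scR[symmetric] scale)
  have self: "cinner f f = complex_of_real (\<Sum>n. (norm (h2_coeff f n))\<^sup>2)"
    by transfer (simp add: cinner_self suminf_of_real)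
  have sm: "summable (\<lambda>n. (norm (h2_coeff f n))\<^sup>2)" using h2_coeff[of f] by simp
  show "0 \<le> inner f f" by (simp add: inner_h2_def self suminf_nonneg sm)
  have "(inner f f = 0) = (\<forall>n. h2_coeff f n = 0)"
    using suminf_eq_zero_iff[OF sm] by (simp add: inner_h2_def self)
  also have "\<dots> = (f = 0)" by transfer auto
  finally show "(inner f f = 0) = (f = 0)" .
  show "norm f = sqrt (inner f f)" by (rule norm_h2_def)
  show "sgn f = inverse (norm f) *\<^sub>R f" by (rule sgn_h2_def)
  show "dist f g = norm (f - g)" by (rule dist_h2_def)
  show "uniformity = (INF e\<in>{0<..}. principal {(f :: 'a h2, g). dist f g < e})"
    by (rule uniformity_h2_def)
  show "open U = (\<forall>f\<in>U. eventually (\<lambda>(f', g). f' = f \<longrightarrow> g \<in> U) uniformity)" for U :: "'a h2 set"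
    by (rule open_h2_def)
qed

end

lemma norm_h2: "norm f = sqrt (\<Sum>n. (norm (h2_coeff f n))\<^sup>2)"
proof -
  have "cinner f f = complex_of_real (\<Sum>n. (norm (h2_coeff f n))\<^sup>2)"
    by transfer (simp add: cinner_self suminf_of_real)
  then show ?thesis by (simp add: norm_h2_def inner_h2_def)
qed

lemma h2_coeff_diff: "h2_coeff (f - g) n = h2_coeff f n - h2_coeff g n"
  by transfer simp

lemma h2_coeff_summable: "summable (\<lambda>n. (norm (h2_coeff f n))\<^sup>2)"
  using h2_coeff[of f] by simp

lemma h2_partial_sum_le: "(\<Sum>n<N. (norm (h2_coeff f n))\<^sup>2) \<le> (norm f)\<^sup>2"
  by (simp add: norm_h2 suminf_nonneg h2_coeff_summable sum_le_suminf)

lemma h2_norm_leI: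
  assumes "0 \<le> K" "\<And>N. (\<Sum>n<N. (norm (f n))\<^sup>2) \<le> K\<^sup>2"
  shows "summable (\<lambda>n. (norm (f n))\<^sup>2)" "norm (Abs_h2 f) \<le> K"
proof -
  show *: "summable (\<lambda>n. (norm (f n))\<^sup>2)"
    by (rule bounded_imp_summable[where B = "K\<^sup>2"])
      (use assms(2)[of "Suc _"] in \<open>simp_all add: lessThan_Suc_atMost\<close>)
  have "(\<Sum>n. (norm (f n))\<^sup>2) \<le> K\<^sup>2"
    by (rule suminf_le_const[OF * assms(2)])
  then show "norm (Abs_h2 f) \<le> K"
    using * assms(1) by (simp add: norm_h2 Abs_h2_inverse real_le_lsqrt suminf_nonneg)
qed

instance h2 :: ("{complex_inner,complete_space}") complete_space
proof
  fix X :: "nat \<Rightarrow> 'a h2"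
  assume X: "Cauchy X"
  have le: "norm (h2_coeff f n) \<le> norm f" for f :: "'a h2" and n
  proof (rule power2_le_imp_le)
    have "(norm (h2_coeff f n))\<^sup>2 \<le> (\<Sum>k<Suc n. (norm (h2_coeff f k))\<^sup>2)"
      by (rule member_le_sum) auto
    then show "(norm (h2_coeff f n))\<^sup>2 \<le> (norm f)\<^sup>2"
      using h2_partial_sum_le[of f "Suc n"] by linarith
  qed simp
  have "Cauchy (\<lambda>m. h2_coeff (X m) n)" for n
  proof (rule metric_CauchyI)
    fix e :: real assume "e > 0"
    then obtain M where M: "\<And>i j. i \<ge> M \<Longrightarrow> j \<ge> M \<Longrightarrow> dist (X i) (X j) < e"
      using metric_CauchyD[OF X] by metis
    have "dist (h2_coeff (X i) n) (h2_coeff (X j) n) \<le> dist (X i) (X j)" for i j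
      using le[of "X i - X j" n] by (simp add: dist_norm h2_coeff_diff)
    then show "\<exists>M. \<forall>i\<ge>M. \<forall>j\<ge>M. dist (h2_coeff (X i) n) (h2_coeff (X j) n) < e"
      using M by (meson le_less_trans)
  qed
  then have "\<forall>n. \<exists>l. (\<lambda>m. h2_coeff (X m) n) \<longlonglongrightarrow> l"
    using Cauchy_convergent convergent_def by blast
  then obtain f where f: "\<And>n. (\<lambda>m. h2_coeff (X m) n) \<longlonglongrightarrow> f n" by metis
  have near: "\<exists>M. \<forall>i\<ge>M. \<forall>N. (\<Sum>n<N. (norm (h2_coeff (X i) n - f n))\<^sup>2) \<le> e\<^sup>2" if "e > 0" for e
  proof -
    obtain M where M: "\<And>i j. i \<ge> M \<Longrightarrow> j \<ge> M \<Longrightarrow> dist (X i) (X j) < e"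
      using metric_CauchyD[OF X \<open>e > 0\<close>] by metis
    have "(\<Sum>n<N. (norm (h2_coeff (X i) n - f n))\<^sup>2) \<le> e\<^sup>2" if "i \<ge> M" for i N
    proof (rule LIMSEQ_le_const2)
      show "(\<lambda>j. \<Sum>n<N. (norm (h2_coeff (X i) n - h2_coeff (X j) n))\<^sup>2)
              \<longlonglongrightarrow> (\<Sum>n<N. (norm (h2_coeff (X i) n - f n))\<^sup>2)"
        by (intro tendsto_intros f)
      have "(\<Sum>n<N. (norm (h2_coeff (X i) n - h2_coeff (X j) n))\<^sup>2) \<le> e\<^sup>2" if "j \<ge> M" for j
      proof -
        have "norm (X i - X j) \<le> e"
          using M[OF \<open>i \<ge> M\<close> \<open>j \<ge> M\<close>] by (simp add: dist_norm)
        then have "(norm (X i - X j))\<^sup>2 \<le> e\<^sup>2" by (intro power_mono) auto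
        then show ?thesis
          using h2_partial_sum_le[of "X i - X j" N] by (simp add: h2_coeff_diff)
      qed
      then show "\<exists>M. \<forall>j\<ge>M. (\<Sum>n<N. (norm (h2_coeff (X i) n - h2_coeff (X j) n))\<^sup>2) \<le> e\<^sup>2"
        by blast
    qed
    then show ?thesis by blast
  qed
  obtain M where "\<And>N. (\<Sum>n<N. (norm (h2_coeff (X M) n - f n))\<^sup>2) \<le> 1\<^sup>2"
    using near[of 1] by (meson order_refl zero_less_one)
  then have "summable (\<lambda>n. (norm (h2_coeff (X M) n - f n))\<^sup>2)"
    by (intro h2_norm_leI(1)[of 1]) auto
  then have "summable (\<lambda>n. (norm (f n - h2_coeff (X M) n))\<^sup>2)"
    by (simp add: norm_minus_commute)
  from h2_add_summable[OF this h2_coeff_summable[of "X M"]]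
  have F: "h2_coeff (Abs_h2 f) = f" by (simp add: Abs_h2_inverse)
  have "X \<longlonglongrightarrow> Abs_h2 f"
  proof (rule metric_LIMSEQ_I)
    fix e :: real assume "e > 0"
    then obtain M where M: "\<And>i N. i \<ge> M \<Longrightarrow> (\<Sum>n<N. (norm (h2_coeff (X i) n - f n))\<^sup>2) \<le> (e / 2)\<^sup>2"
      using near[of "e / 2"] by auto
    have "dist (X i) (Abs_h2 f) < e" if "i \<ge> M" for i
    proof -
      have "norm (Abs_h2 (h2_coeff (X i - Abs_h2 f))) \<le> e / 2"
        using M[OF that] \<open>e > 0\<close> by (intro h2_norm_leI(2)) (auto simp: h2_coeff_diff F)
      then show ?thesis using \<open>e > 0\<close> by (simp add: h2_coeff_inverse dist_norm)
    qed
    then show "\<exists>M. \<forall>i\<ge>M. dist (X i) (Abs_h2 f) < e" by blast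
  qed
  then show "convergent X" by (auto simp: convergent_def)
qed

instance h2 :: ("{complex_inner,polish_space}") polish_space
proof
  obtain D :: "'a set" where D: "countable D" "\<And>U. open U \<Longrightarrow> U \<noteq> {} \<Longrightarrow> \<exists>d\<in>D. d \<in> U"
    using countable_dense_exists by auto
  define fin where "fin xs = Abs_h2 (\<lambda>n. if n < length xs then xs ! n else (0::'a))" for xs
  have fin: "h2_coeff (fin xs) = (\<lambda>n. if n < length xs then xs ! n else 0)" for xs
  proof -
    have "summable (\<lambda>n. (norm (if n < length xs then xs ! n else 0))\<^sup>2)"
      by (rule summable_finite[of "{..<length xs}"]) auto
    then show ?thesis by (simp add: fin_def Abs_h2_inverse)
  qed
  have dense: "\<exists>xs\<in>lists D. dist f (fin xs) < e" if "e > 0" for f :: "'a h2" and e :: real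
  proof -
    obtain N where N: "norm (\<Sum>n. (norm (h2_coeff f (n + N)))\<^sup>2) < e\<^sup>2 / 2"
      using suminf_exist_split[OF _ h2_coeff_summable[of f], of "e\<^sup>2 / 2"] \<open>e > 0\<close> by auto
    define c where "c = e / sqrt (2 * (N + 1))"
    have c: "c > 0" "N * c\<^sup>2 \<le> e\<^sup>2 / 2"
      using \<open>e > 0\<close> by (simp_all add: c_def power_divide field_simps)
    have "\<exists>d\<in>D. dist (h2_coeff f n) d < c" for n
      using D(2)[of "ball (h2_coeff f n) c"] c by auto
    then obtain d where d: "\<And>n. d n \<in> D" "\<And>n. dist (h2_coeff f n) (d n) < c" by metis
    define xs where "xs = map d [0..<N]"
    let ?g = "\<lambda>n. (norm (h2_coeff (f - fin xs) n))\<^sup>2"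
    have "(\<Sum>n. ?g n) = (\<Sum>n. ?g (n + N)) + (\<Sum>n<N. ?g n)"
      by (rule suminf_split_initial_segment) (rule h2_coeff_summable)
    also have "(\<Sum>n. ?g (n + N)) < e\<^sup>2 / 2"
      using N by (simp add: h2_coeff_diff fin xs_def)
    also have "(\<Sum>n<N. ?g n) \<le> (\<Sum>n<N. c\<^sup>2)"
    proof (intro sum_mono power_mono)
      fix n assume "n \<in> {..<N}"
      then show "norm (h2_coeff (f - fin xs) n) \<le> c"
        using d(2)[of n] by (simp add: h2_coeff_diff fin xs_def dist_norm)
    qed simp
    also have "\<dots> \<le> e\<^sup>2 / 2" using c by simp
    finally have "(\<Sum>n. ?g n) < e\<^sup>2" by simp
    then have "norm (f - fin xs) < e"
      unfolding norm_h2 using \<open>e > 0\<close> by (intro real_less_lsqrt) (auto simp: suminf_nonneg h2_coeff_summable)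
    moreover have "xs \<in> lists D" using d(1) by (auto simp: xs_def)
    ultimately show ?thesis by (auto simp: dist_norm)
  qed
  define B where "B = (\<lambda>(xs, k). ball (fin xs) (inverse (real (Suc k)))) ` (lists D \<times> UNIV)"
  have "topological_basis B"
  proof (rule topological_basisI)
    show "open U" if "U \<in> B" for U using that by (auto simp: B_def)
  next
    fix U :: "'a h2 set" and f assume "open U" "f \<in> U"
    then obtain e where e: "e > 0" "ball f e \<subseteq> U" by (meson open_contains_ball)
    obtain k where k: "inverse (real (Suc k)) < e / 2"
      using reals_Archimedean[of "e / 2"] e by auto
    obtain xs where xs: "xs \<in> lists D" "dist f (fin xs) < inverse (real (Suc k))"
      using dense[of "inverse (real (Suc k))" f] by auto
    have "ball (fin xs) (inverse (real (Suc k))) \<subseteq> ball f e"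
    proof
      fix g assume "g \<in> ball (fin xs) (inverse (real (Suc k)))"
      then have "dist (fin xs) g < e / 2" using k by simp
      moreover have "dist f (fin xs) < e / 2" using xs k by linarith
      ultimately show "g \<in> ball f e"
        using dist_triangle[of f g "fin xs"] by simp
    qed
    then show "\<exists>V\<in>B. f \<in> V \<and> V \<subseteq> U"
      using e xs by (intro bexI[of _ "ball (fin xs) (inverse (real (Suc k)))"])
        (auto simp: B_def dist_commute)
  qed
  moreover have "countable B"
    using D(1) by (auto simp: B_def)
  ultimately show "\<exists>B::'a h2 set set. countable B \<and> open = generate_topology B"
    using topological_basis_imp_subbasis by blast
qed

definition h2_eval :: "'a::complex_inner h2 \<Rightarrow> complex \<Rightarrow> 'a"
  where "h2_eval f z = (\<Sum>n. z ^ n *\<^sub>C h2_coeff f n)"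

definition H2 :: "'e::complex_inner set \<Rightarrow> 'e h2 set"
  where "H2 E = {f. \<forall>n. h2_coeff f n \<in> E}"

text \<open>
  \<^term>\<open>mult_op \<Phi>\<close> is multiplication by the operator-valued function \<open>\<Phi>\<close> on the disc: it sends \<open>f\<close>
  to the (at most one) element of the Hardy space whose value at each \<open>z\<close> is \<open>\<Phi> z\<close> applied to
  the value of \<open>f\<close> at \<open>z\<close>.
\<close>

definition mult_op :: "(complex \<Rightarrow> 'e \<Rightarrow> 'f) \<Rightarrow> 'e::complex_inner h2 \<Rightarrow> 'f::complex_inner h2"
  where "mult_op \<Phi> f = (THE g. \<forall>z\<in>ball 0 1. h2_eval g z = \<Phi> z (h2_eval f z))"

definition M_z :: "'e::complex_inner h2 \<Rightarrow> 'e h2"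
  where "M_z = mult_op (\<lambda>z h. z *\<^sub>C h)"

text \<open>
  Every separable Hilbert space is unitarily equivalent to a closed subspace of \<open>\<ell>\<^sup>2\<close>; this type
  therefore serves as a universe when a Hilbert space has to be quantified existentially.
\<close>

type_synonym ell2 = "complex h2"


section \<open>Operators on closed subspaces\<close>

text \<open>
  A Hilbert space \<open>E\<close> is a closed complex subspace of a type, and an operator on it is a function on
  that type of which only the values on \<open>E\<close> are relevant.
\<close>

definition bounded_op :: "'e::complex_inner set \<Rightarrow> 'f::complex_inner set \<Rightarrow> ('e \<Rightarrow> 'f) \<Rightarrow> bool"
  where "bounded_op E F T \<longleftrightarrow>
    (\<forall>x\<in>E. T x \<in> F) \<and>
    (\<forall>x\<in>E. \<forall>y\<in>E. T (x + y) = T x + T y) \<and>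
    (\<forall>a. \<forall>x\<in>E. T (a *\<^sub>C x) = a *\<^sub>C T x) \<and>
    (\<exists>K. \<forall>x\<in>E. norm (T x) \<le> K * norm x)"

definition unitary_op :: "'e::complex_inner set \<Rightarrow> 'f::complex_inner set \<Rightarrow> ('e \<Rightarrow> 'f) \<Rightarrow> bool"
  where "unitary_op E F U \<longleftrightarrow>
    bounded_op E F U \<and> U ` E = F \<and> (\<forall>x\<in>E. \<forall>y\<in>E. cinner (U x) (U y) = cinner x y)"

definition adjoint_op :: "'e::complex_inner set \<Rightarrow> ('e \<Rightarrow> 'e) \<Rightarrow> 'e \<Rightarrow> 'e"
  where "adjoint_op E T y = (THE x. x \<in> E \<and> (\<forall>h\<in>E. cinner (T h) y = cinner h x))"

definition numerical_radius :: "'e::complex_inner set \<Rightarrow> ('e \<Rightarrow> 'e) \<Rightarrow> real"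
  where "numerical_radius E T = (SUP h\<in>{h\<in>E. norm h \<le> 1}. cmod (cinner (T h) h))"

text \<open>The operator \<open>A + A\<^sup>* M\<^sub>z\<close>, that is, multiplication by \<open>z \<mapsto> A + A\<^sup>* z\<close>.\<close>

definition M_pencil :: "'e::complex_inner set \<Rightarrow> ('e \<Rightarrow> 'e) \<Rightarrow> 'e h2 \<Rightarrow> 'e h2"
  where "M_pencil E A = mult_op (\<lambda>z h. A h + z *\<^sub>C adjoint_op E A h)"


section \<open>Inner functions and Beurling-Lax-Halmos representations\<close>

text \<open>
  Bounded analytic functions on the disc with values in the operators from \<open>E\<close> to \<open>F\<close>; analyticity
  of an operator-valued function is expressed through its matrix coefficients.
\<close>

definition H_infty ::
  "'e::complex_inner set \<Rightarrow> 'f::complex_inner set \<Rightarrow> (complex \<Rightarrow> 'e \<Rightarrow> 'f) set"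
  where "H_infty E F = {\<Theta>.
    (\<forall>z\<in>ball 0 1. bounded_op E F (\<Theta> z)) \<and>
    (\<forall>h\<in>E. \<forall>k\<in>F. (\<lambda>z. cinner (\<Theta> z h) k) holomorphic_on ball 0 1) \<and>
    (\<exists>K. \<forall>z\<in>ball 0 1. \<forall>h\<in>E. norm (\<Theta> z h) \<le> K * norm h)}"

text \<open>
  \<open>\<Theta>\<close> is inner when multiplication by \<open>\<Theta>\<close> is an isometry from the Hardy space of \<open>E\<close> into
  that of \<open>F\<close> (equivalently, its boundary values are isometries almost everywhere on the circle).
\<close>

definition inner_function ::
  "'e::complex_inner set \<Rightarrow> 'f::complex_inner set \<Rightarrow> (complex \<Rightarrow> 'e \<Rightarrow> 'f) \<Rightarrow> bool"
  where "inner_function E F \<Theta> \<longleftrightarrow> \<Theta> \<in> H_infty E F \<and>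
    (\<forall>f\<in>H2 E. mult_op \<Theta> f \<in> H2 F \<and> norm (mult_op \<Theta> f) = norm f)"

definition BLH_representation ::
  "'f::complex_inner h2 set \<Rightarrow> 'e::complex_inner set \<Rightarrow> (complex \<Rightarrow> 'e \<Rightarrow> 'f) \<Rightarrow> bool"
  where "BLH_representation S E \<Theta> \<longleftrightarrow>
    closed E \<and> csubspace E \<and> inner_function E UNIV \<Theta> \<and> S = mult_op \<Theta> ` H2 E"

definition intertwines ::
  "('f::complex_inner \<Rightarrow> 'f) \<Rightarrow> 'e::complex_inner set \<Rightarrow> (complex \<Rightarrow> 'e \<Rightarrow> 'f) \<Rightarrow> ('e \<Rightarrow> 'e) \<Rightarrow> bool"
  where "intertwines A E \<Theta> B \<longleftrightarrow>
    bounded_op E E B \<and> numerical_radius E B \<le> 1 \<and>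
    (\<forall>f\<in>H2 E. M_pencil UNIV A (mult_op \<Theta> f) = mult_op \<Theta> (M_pencil E B f))"

end

theory Submission
  imports Defs "HOL-Library.Real_Mod"
begin

text \<open>
  Write \<open>P\<^sub>A\<close> for the pencil \<open>A + A\<^sup>* M\<^sub>z\<close> and \<open>V\<close> for multiplication by the inner function \<open>\<Theta>\<close>, an
  isometry of \<^term>\<open>H2 E\<close> onto \<open>S\<close> that commutes with the shift \<open>M\<^sub>z\<close>.  The intertwining relation
  \<open>P\<^sub>A V = V P\<^sub>B\<close> shows at once that \<open>S\<close> is invariant.  For the converse, invariance provides an operator
  \<open>X\<close> on \<^term>\<open>H2 E\<close> with \<open>P\<^sub>A V = V X\<close>, and it has to be shown that \<open>X\<close> is the pencil of an operator \<open>B\<close>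
  with numerical radius at most one.

  Two properties of \<open>P\<^sub>A\<close> are expressed by inner products and the shift alone, and therefore pass to
  \<open>X\<close>.  The first is the symmetry \<open>\<langle>P\<^sub>A f, z g\<rangle> = \<langle>f, P\<^sub>A g\<rangle>\<close> (\<open>M_pencil_symmetric\<close>); a bounded operator
  commuting with the shift and having this symmetry is a pencil (\<open>pencil_if_symmetric\<close>), because
  it maps constants to polynomials of degree at most one whose coefficients are adjoint to each
  other.  The second is the bound \<open>|\<langle>P\<^sub>A f, f\<rangle>| \<le> 2 \<parallel>f\<parallel>\<^sup>2\<close>, which is equivalent to \<open>w(A) \<le> 1\<close>
  (\<open>cmod_cinner_M_pencil_le\<close>, \<open>numerical_radius_le_1_if_M_pencil_bounded\<close>).  Roots of unity take the
  place of integration over the circle in one direction, truncated geometric series that of boundary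
  values in the other.

  A representation exists for every closed shift-invariant subspace (\<open>BLH_representation_exists\<close>): \<open>S\<close> is
  the orthogonal sum of the subspaces \<open>z\<^sup>n W\<close>, where \<open>W\<close> is the complement of \<open>z S\<close> in \<open>S\<close>, and a copy
  of \<open>W\<close> in \<open>\<ell>\<^sup>2\<close> serves as the coefficient space.  Two representations of the same \<open>S\<close> are related by a
  unitary operator that commutes with the shift, hence preserves constants and is a constant unitary
  factor; comparing zeroth coefficients shows that this factor also carries \<open>B\<close> to \<open>B'\<close>
  (\<open>intertwined_operator_unique\<close>).
\<close>

section \<open>Geometry of complex inner product spaces\<close>

lemma cinner_add_right: "cinner x (y + z) = cinner x y + cinner x (z :: 'a::complex_inner)"
  by (metis cinner_add_left cinner_commute complex_cnj_add)

lemma cinner_scaleC_right: "cinner x (a *\<^sub>C y) = cnj a * cinner x (y :: 'a::complex_inner)"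
  by (metis cinner_commute cinner_scaleC_left complex_cnj_mult)

lemma cinner_scaleR_left: "cinner (r *\<^sub>R x) y = of_real r * cinner x (y :: 'a::complex_inner)"
  by (metis cinner_scaleC_left scaleC_of_real)

lemma cinner_scaleR_right: "cinner x (r *\<^sub>R y) = of_real r * cinner x (y :: 'a::complex_inner)"
  by (metis cinner_scaleC_right scaleC_of_real complex_cnj_complex_of_real)

lemma bounded_linear_cinner_left: "bounded_linear (\<lambda>x. cinner x (y :: 'a::complex_inner))"
  by (rule bounded_linear_intro[of _ "norm y"])
    (simp_all add: cinner_add_left cinner_scaleR_left cmod_cinner_le scaleR_conv_of_real)

lemma bounded_linear_cinner_right: "bounded_linear (cinner (x :: 'a::complex_inner))"
  by (rule bounded_linear_intro[of _ "norm x"])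
    (simp_all add: cinner_add_right cinner_scaleR_right mult.commute[of _ "norm x"] cmod_cinner_le
      scaleR_conv_of_real)

lemma bounded_linear_scaleC: "bounded_linear (\<lambda>x :: 'a::complex_inner. a *\<^sub>C x)"
  by (rule bounded_linear_intro[of _ "cmod a"])
    (simp_all add: scaleC_add_right norm_scaleC mult.commute
      scaleC_of_real[symmetric] scaleC_scaleC)

lemma cinner_zero_right [simp]: "cinner (x :: 'a::complex_inner) 0 = 0"
  by (rule linear_0) (rule bounded_linear.linear[OF bounded_linear_cinner_right])

lemmas cinner_diff_left = linear_diff[OF bounded_linear.linear[OF bounded_linear_cinner_left]]
lemmas cinner_diff_right = linear_diff[OF bounded_linear.linear[OF bounded_linear_cinner_right]]
lemmas cinner_sum_left = linear_sum[OF bounded_linear.linear[OF bounded_linear_cinner_left]]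
lemmas cinner_sum_right = linear_sum[OF bounded_linear.linear[OF bounded_linear_cinner_right]]

lemma cinner_eq_zero_commute: "cinner x y = 0 \<Longrightarrow> cinner y (x :: 'a::complex_inner) = 0"
  by (metis cinner_commute complex_cnj_zero)

lemma cinner_self_eq_zero [simp]: "cinner x x = 0 \<longleftrightarrow> x = (0 :: 'a::complex_inner)"
  by (simp add: cinner_self)

lemma norm_add_orthogonal:
  assumes "cinner x (y :: 'a::complex_inner) = 0"
  shows "(norm (x + y))\<^sup>2 = (norm x)\<^sup>2 + (norm y)\<^sup>2"
  using assms by (intro norm_add_Pythagorean) (simp add: orthogonal_def inner_eq_Re_cinner)

lemma csubspaceD:
  assumes "csubspace (E :: 'a::complex_inner set)"
  shows "0 \<in> E" "x \<in> E \<Longrightarrow> y \<in> E \<Longrightarrow> x + y \<in> E" "x \<in> E \<Longrightarrow> a *\<^sub>C x \<in> E"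
    "x \<in> E \<Longrightarrow> y \<in> E \<Longrightarrow> x - y \<in> E" "x \<in> E \<Longrightarrow> - x \<in> E" "x \<in> E \<Longrightarrow> r *\<^sub>R x \<in> E"
    "(\<And>i. i \<in> I \<Longrightarrow> f i \<in> E) \<Longrightarrow> sum f I \<in> E"
  using complex_vector.subspace_scale[OF assms, of x "of_real r"]
  by (simp_all add: assms complex_vector.subspace_0 complex_vector.subspace_add
      complex_vector.subspace_scale complex_vector.subspace_diff complex_vector.subspace_neg
      complex_vector.subspace_sum scaleC_of_real)

lemma cinner_eq_on_subspace:
  assumes "csubspace E" "x \<in> E" "y \<in> E" "\<And>k. k \<in> E \<Longrightarrow> cinner x k = cinner y k"
  shows "x = (y :: 'a::complex_inner)"
proof -
  have "cinner (x - y) (x - y) = 0"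
    using assms csubspaceD(4)[OF assms(1-3)] by (simp add: cinner_diff_left)
  then show ?thesis by simp
qed

text \<open>
  The exponent serves two purposes: \<open>p = 1\<close> gives absolutely convergent series, \<open>p = 2\<close> orthogonal
  ones.
\<close>

lemma summable_if_blocks_le:
  fixes f :: "nat \<Rightarrow> 'a::{real_normed_vector,complete_space}" and g :: "nat \<Rightarrow> real"
  assumes g: "summable g" and "p > 0"
    and le: "\<And>M N. M \<le> N \<Longrightarrow> (norm (\<Sum>n=M..<N. f n)) ^ p \<le> (\<Sum>n=M..<N. g n)"
  shows "summable f"
proof -
  have C: "Cauchy (\<lambda>N. \<Sum>n<N. g n)"
    using g by (simp add: summable_iff_convergent convergent_Cauchy)
  have dist_le: "(dist (\<Sum>n<M. f n) (\<Sum>n<N. f n)) ^ p \<le> dist (\<Sum>n<M. g n) (\<Sum>n<N. g n)" for M N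
  proof (induction M N rule: linorder_wlog)
    case (le M N)
    have "(\<Sum>n<N. f n) - (\<Sum>n<M. f n) = (\<Sum>n=M..<N. f n)"
      "(\<Sum>n<N. g n) - (\<Sum>n<M. g n) = (\<Sum>n=M..<N. g n)"
      using le by (simp_all add: lessThan_atLeast0 sum_diff_nat_ivl)
    then have "dist (\<Sum>n<M. f n) (\<Sum>n<N. f n) = norm (\<Sum>n=M..<N. f n)"
      "dist (\<Sum>n<M. g n) (\<Sum>n<N. g n) = \<bar>\<Sum>n=M..<N. g n\<bar>"
      by (metis dist_norm dist_commute real_norm_def)+
    then show ?case using assms(3)[OF le] by simp
  qed (simp add: dist_commute)
  have "Cauchy (\<lambda>N. \<Sum>n<N. f n)"
    unfolding Cauchy_def
  proof (intro allI impI)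
    fix e :: real assume "e > 0"
    then have "e ^ p > 0" by simp
    then obtain K where
      K: "\<And>m n. m \<ge> K \<Longrightarrow> n \<ge> K \<Longrightarrow> dist (\<Sum>n<m. g n) (\<Sum>n<n. g n) < e ^ p"
      using C unfolding Cauchy_def by meson
    have "dist (\<Sum>n<m. f n) (\<Sum>n<n. f n) < e" if "m \<ge> K" "n \<ge> K" for m n
      by (rule power_less_imp_less_base[of _ p])
        (use dist_le[of m n] K[OF that] \<open>e > 0\<close> in simp_all)
    then show "\<exists>K. \<forall>m\<ge>K. \<forall>n\<ge>K. dist (\<Sum>n<m. f n) (\<Sum>n<n. f n) < e" by blast
  qed
  then show ?thesis by (simp add: summable_iff_convergent Cauchy_convergent_iff)
qed

lemma absolutely_summable_imp_summable:
  fixes f :: "nat \<Rightarrow> 'a::{real_normed_vector,complete_space}"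
  assumes "summable (\<lambda>n. norm (f n))"
  shows "summable f"
  by (rule summable_if_blocks_le[OF assms, of 1]) (simp_all add: norm_sum)

lemma orthogonal_series:
  fixes v :: "nat \<Rightarrow> 'a::{complex_inner,complete_space}"
  assumes orth: "\<And>m n. m < n \<Longrightarrow> cinner (v m) (v n) = 0"
    and sm: "summable (\<lambda>n. (norm (v n))\<^sup>2)"
  shows "summable v" "(norm (\<Sum>n. v n))\<^sup>2 = (\<Sum>n. (norm (v n))\<^sup>2)"
proof -
  have fin: "(norm (\<Sum>n=M..<N. v n))\<^sup>2 = (\<Sum>n=M..<N. (norm (v n))\<^sup>2)" for M N
  proof (induction N)
    case (Suc N)
    have "cinner (\<Sum>n=M..<N. v n) (v N) = 0"
      unfolding cinner_sum_left by (rule sum.neutral) (simp add: orth)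
    then show ?case using Suc by (cases "M \<le> N") (simp_all add: norm_add_orthogonal)
  qed simp
  show sv: "summable v"
    by (rule summable_if_blocks_le[OF sm, of 2]) (simp_all add: fin)
  have "(\<lambda>N. (norm (\<Sum>n<N. v n))\<^sup>2) \<longlonglongrightarrow> (norm (\<Sum>n. v n))\<^sup>2"
    using summable_LIMSEQ[OF sv] by (intro tendsto_intros)
  moreover have "(\<lambda>N. (norm (\<Sum>n<N. v n))\<^sup>2) = (\<lambda>N. \<Sum>n<N. (norm (v n))\<^sup>2)"
    using fin[of 0] by (simp add: lessThan_atLeast0)
  ultimately show "(norm (\<Sum>n. v n))\<^sup>2 = (\<Sum>n. (norm (v n))\<^sup>2)"
    using summable_LIMSEQ[OF sm] LIMSEQ_unique by metis
qed

text \<open>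
  A minimising sequence for the distance from \<open>x\<close> is Cauchy by the
  parallelogram law, and at a minimiser the difference is orthogonal to the subspace.
\<close>

lemma orthogonal_projection:
  fixes C :: "'a::{complex_inner,complete_space} set"
  assumes C: "closed C" "csubspace C"
  obtains p where "p \<in> C" "\<And>y. y \<in> C \<Longrightarrow> cinner (x - p) y = 0"
proof -
  note sub = csubspaceD[OF C(2)]
  define d where "d = infdist x C"
  have ne: "C \<noteq> {}" using sub(1) by blast
  have d0: "d \<ge> 0" by (simp add: d_def infdist_nonneg)
  have dle: "d \<le> norm (x - y)" if "y \<in> C" for y
    using infdist_le[OF that, of x] by (simp add: d_def dist_norm)
  have "\<exists>y\<in>C. norm (x - y) < d + e" if "e > 0" for e
  proof (rule ccontr)
    assume "\<not> ?thesis"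
    then have "d + e \<le> infdist x C"
      using ne by (auto simp: infdist_def dist_norm not_less intro!: cINF_greatest)
    then show False using that by (simp add: d_def)
  qed
  then have "\<forall>n. \<exists>y\<in>C. norm (x - y) < d + 1 / real (Suc n)" by simp
  then obtain y where yC: "\<And>n. y n \<in> C" and y: "\<And>n. norm (x - y n) < d + 1 / real (Suc n)"
    by metis
  have lim: "(\<lambda>n. norm (x - y n)) \<longlonglongrightarrow> d"
  proof (rule tendsto_sandwich[of "\<lambda>_. d" _ _ "\<lambda>n. d + 1 / real (Suc n)"])
    show "(\<lambda>n. d + 1 / real (Suc n)) \<longlonglongrightarrow> d"
      using tendsto_add[OF tendsto_const[of d] lim_1_over_n[THEN LIMSEQ_Suc]] by simp
    show "\<forall>\<^sub>F n in sequentially. norm (x - y n) \<le> d + 1 / real (Suc n)"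
      using y by (intro always_eventually allI less_imp_le)
    show "\<forall>\<^sub>F n in sequentially. d \<le> norm (x - y n)"
      using dle[OF yC] by (intro always_eventually allI)
  qed simp
  have par: "(norm (y m - y n))\<^sup>2 \<le> 2 * ((norm (x - y m))\<^sup>2 - d\<^sup>2) + 2 * ((norm (x - y n))\<^sup>2 - d\<^sup>2)" for m n
  proof -
    have "d \<le> norm (x - (1/2) *\<^sub>R (y m + y n))" by (intro dle sub yC)
    then have "d\<^sup>2 \<le> (norm (x - (1/2) *\<^sub>R (y m + y n)))\<^sup>2" using d0 by (intro power_mono)
    moreover have "(norm (y m - y n))\<^sup>2 + 4 * (norm (x - (1/2) *\<^sub>R (y m + y n)))\<^sup>2
        = 2 * (norm (x - y m))\<^sup>2 + 2 * (norm (x - y n))\<^sup>2"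
      unfolding power2_norm_eq_inner
      by (simp add: inner_diff_left inner_diff_right inner_add_left inner_add_right
          inner_commute[of x "y m"] inner_commute[of x "y n"] inner_commute[of "y m" "y n"] field_simps)
    ultimately show ?thesis by (simp add: algebra_simps)
  qed
  have "(\<lambda>n. 2 * ((norm (x - y n))\<^sup>2 - d\<^sup>2)) \<longlonglongrightarrow> 2 * (d\<^sup>2 - d\<^sup>2)"
    by (intro tendsto_intros lim)
  then have lim2: "(\<lambda>n. 2 * ((norm (x - y n))\<^sup>2 - d\<^sup>2)) \<longlonglongrightarrow> 0" by simp
  have "Cauchy y"
    unfolding Cauchy_def
  proof (intro allI impI)
    fix e :: real assume "e > 0"
    then have "e\<^sup>2 / 2 > 0" by simp
    then obtain K where K: "\<And>n. n \<ge> K \<Longrightarrow> \<bar>2 * ((norm (x - y n))\<^sup>2 - d\<^sup>2)\<bar> < e\<^sup>2 / 2"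
      using LIMSEQ_D[OF lim2] by (metis diff_zero real_norm_def)
    have "dist (y m) (y n) < e" if "m \<ge> K" "n \<ge> K" for m n
    proof (rule power2_less_imp_less)
      show "(dist (y m) (y n))\<^sup>2 < e\<^sup>2"
        using par[of m n] K[OF that(1)] K[OF that(2)] unfolding dist_norm by linarith
    qed (use \<open>e > 0\<close> in simp)
    then show "\<exists>K. \<forall>m\<ge>K. \<forall>n\<ge>K. dist (y m) (y n) < e" by blast
  qed
  then obtain p where p: "y \<longlonglongrightarrow> p" using Cauchy_convergent_iff convergent_def by blast
  have pC: "p \<in> C" by (rule closed_sequentially[OF C(1) yC p])
  have "(\<lambda>n. norm (x - y n)) \<longlonglongrightarrow> norm (x - p)" by (intro tendsto_intros p)
  then have np: "norm (x - p) = d" using lim LIMSEQ_unique by blast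
  have re: "inner (x - p) y = 0" if "y \<in> C" for y
  proof (cases "y = 0")
    case False
    define t where "t = inner (x - p) y / (norm y)\<^sup>2"
    have "d \<le> norm (x - (p + t *\<^sub>R y))" by (intro dle sub pC that)
    then have "d\<^sup>2 \<le> (norm (x - p - t *\<^sub>R y))\<^sup>2" using d0 by (intro power_mono) (simp_all add: diff_diff_eq)
    also have "\<dots> = (norm (x - p))\<^sup>2 - 2 * t * inner (x - p) y + t\<^sup>2 * (norm y)\<^sup>2"
      unfolding power2_norm_eq_inner
      by (simp add: inner_diff_left inner_diff_right inner_commute[of y x] inner_commute[of y p] power2_eq_square)
        (simp add: algebra_simps)
    also have "\<dots> = d\<^sup>2 - (inner (x - p) y)\<^sup>2 / (norm y)\<^sup>2"
      using False by (simp add: np t_def power2_eq_square field_simps)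
    finally have "(inner (x - p) y)\<^sup>2 / (norm y)\<^sup>2 \<le> 0" by simp
    then show ?thesis using False by (simp add: divide_le_0_iff)
  qed simp
  have "cinner (x - p) y = 0" if "y \<in> C" for y
  proof (rule complex_eqI)
    show "Re (cinner (x - p) y) = Re 0" using re[OF that] by (simp add: inner_eq_Re_cinner)
    show "Im (cinner (x - p) y) = Im 0"
      using re[OF sub(3)[OF that, of \<i>]] by (simp add: inner_eq_Re_cinner cinner_scaleC_right)
  qed
  then show ?thesis using pC that by blast
qed

section \<open>Bounded operators on closed subspaces\<close>

lemma bounded_opD:
  assumes "bounded_op E F T"
  shows "x \<in> E \<Longrightarrow> T x \<in> F" "x \<in> E \<Longrightarrow> y \<in> E \<Longrightarrow> T (x + y) = T x + T y"
    "x \<in> E \<Longrightarrow> T (a *\<^sub>C x) = a *\<^sub>C T x"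
  using assms unfolding bounded_op_def by blast+

lemma bounded_op_zero:
  assumes "bounded_op E F T" "csubspace E"
  shows "T 0 = 0"
  using bounded_opD(3)[OF assms(1) csubspaceD(1)[OF assms(2)], of 0] by simp

lemma bounded_op_diff:
  assumes "bounded_op E F T" "csubspace E" "x \<in> E" "y \<in> E"
  shows "T (x - y) = T x - T y"
  using bounded_opD(2)[OF assms(1) csubspaceD(4)[OF assms(2-4)] assms(4)] by simp

lemma bounded_op_sum:
  assumes "bounded_op E F T" "csubspace E" "\<And>i. i \<in> I \<Longrightarrow> f i \<in> E"
  shows "T (\<Sum>i\<in>I. f i) = (\<Sum>i\<in>I. T (f i))"
  using assms(3)
proof (induction I rule: infinite_finite_induct)
  case (insert i I)
  then show ?case
    using csubspaceD(7)[OF assms(2), of I f] by (simp add: bounded_opD(2)[OF assms(1)])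
qed (simp_all add: bounded_op_zero[OF assms(1,2)])

lemma bounded_op_bound:
  assumes "bounded_op E F T"
  obtains K where "K > 0" "\<And>x. x \<in> E \<Longrightarrow> norm (T x) \<le> K * norm x"
proof -
  obtain K where K: "\<And>x. x \<in> E \<Longrightarrow> norm (T x) \<le> K * norm x"
    using assms unfolding bounded_op_def by blast
  have "norm (T x) \<le> max K 1 * norm x" if "x \<in> E" for x
    using K[OF that] mult_right_mono[of K "max K 1" "norm x"] by auto
  then show ?thesis by (intro that[of "max K 1"]) auto
qed

lemma bounded_op_sums:
  assumes "bounded_op E F T" "closed E" "csubspace E" "\<And>n. f n \<in> E" "f sums s"
  shows "(\<lambda>n. T (f n)) sums T s" "s \<in> E"
proof -
  have P: "(\<Sum>n<N. f n) \<in> E" for N by (intro csubspaceD(7)[OF assms(3)] assms(4))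
  show s: "s \<in> E" by (rule closed_sequentially[OF assms(2) P]) (use assms(5) in \<open>simp add: sums_def\<close>)
  obtain K where K: "\<And>x. x \<in> E \<Longrightarrow> norm (T x) \<le> K * norm x"
    using bounded_op_bound[OF assms(1)] by blast
  have "(\<lambda>N. T (\<Sum>n<N. f n)) \<longlonglongrightarrow> T s"
  proof (rule Lim_transform_bound[THEN LIM_zero_cancel])
    show "\<forall>\<^sub>F N in sequentially. norm (T (\<Sum>n<N. f n) - T s) \<le> norm (K *\<^sub>R ((\<Sum>n<N. f n) - s))"
    proof (intro always_eventually allI)
      fix N
      have "norm (T (\<Sum>n<N. f n) - T s) \<le> K * norm ((\<Sum>n<N. f n) - s)"
        using K[OF csubspaceD(4)[OF assms(3) P s]] bounded_op_diff[OF assms(1,3) P s] by simp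
      also have "\<dots> \<le> norm (K *\<^sub>R ((\<Sum>n<N. f n) - s))" by (simp add: mult_right_mono)
      finally show "norm (T (\<Sum>n<N. f n) - T s) \<le> norm (K *\<^sub>R ((\<Sum>n<N. f n) - s))" .
    qed
    have "(\<lambda>N. K *\<^sub>R ((\<Sum>n<N. f n) - s)) \<longlonglongrightarrow> K *\<^sub>R (s - s)"
      using assms(5) unfolding sums_def by (intro tendsto_intros)
    then show "(\<lambda>N. K *\<^sub>R ((\<Sum>n<N. f n) - s)) \<longlonglongrightarrow> 0" by simp
  qed
  then show "(\<lambda>n. T (f n)) sums T s"
    unfolding sums_def using bounded_op_sum[OF assms(1,3), of _ f] assms(4) by simp
qed

text \<open>
  A nonzero functional is a multiple of the inner product with any vector
  orthogonal to its kernel.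
\<close>

lemma riesz_representation:
  fixes E :: "'e::{complex_inner,complete_space} set" and \<phi> :: "'e \<Rightarrow> complex"
  assumes E: "closed E" "csubspace E" and \<phi>: "bounded_op E UNIV \<phi>"
  shows "\<exists>x\<in>E. \<forall>h\<in>E. \<phi> h = cinner h x"
proof (cases "\<forall>h\<in>E. \<phi> h = 0")
  case True
  then show ?thesis using csubspaceD(1)[OF E(2)] by (intro bexI[of _ 0]) auto
next
  case False
  then obtain h0 where h0: "h0 \<in> E" "\<phi> h0 \<noteq> 0" by blast
  note sub = csubspaceD[OF E(2)]
  define C where "C = {h\<in>E. \<phi> h = 0}"
  have sc: "\<phi> (a *\<^sub>C x) = a * \<phi> x" if "x \<in> E" for a x
    using bounded_opD(3)[OF \<phi> that] by (simp add: scaleC_complex_def)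
  have "csubspace C"
    unfolding complex_vector.subspace_def C_def
    using sub bounded_op_zero[OF \<phi> E(2)] bounded_opD(2)[OF \<phi>] sc by auto
  moreover have "closed C"
    unfolding closed_sequential_limits
  proof (intro allI impI, elim conjE)
    fix x l assume x: "\<forall>n. x n \<in> C" "x \<longlonglongrightarrow> l"
    then have l: "l \<in> E" using closed_sequentially[OF E(1), of x l] by (simp add: C_def)
    obtain K where K: "\<And>x. x \<in> E \<Longrightarrow> norm (\<phi> x) \<le> K * norm x"
      using bounded_op_bound[OF \<phi>] by blast
    have "norm (\<phi> l) \<le> K * norm (l - x n)" for n
      using K[of "l - x n"] x(1) l sub(4) bounded_op_diff[OF \<phi> E(2), of l "x n"]
      by (simp add: C_def)
    moreover have "(\<lambda>n. K * norm (l - x n)) \<longlonglongrightarrow> K * norm (l - l)"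
      by (intro tendsto_intros x)
    ultimately have "norm (\<phi> l) \<le> K * norm (l - l)"
      by (intro LIMSEQ_le_const) auto
    then show "l \<in> C" using l by (simp add: C_def)
  qed
  ultimately obtain p where p: "p \<in> C" "\<And>y. y \<in> C \<Longrightarrow> cinner (h0 - p) y = 0"
    using orthogonal_projection by blast
  define u where "u = h0 - p"
  have u: "u \<in> E" "\<phi> u \<noteq> 0"
    using p(1) h0 sub(4) bounded_op_diff[OF \<phi> E(2), of h0 p] by (auto simp: u_def C_def)
  then have u0: "u \<noteq> 0" using bounded_op_zero[OF \<phi> E(2)] by auto
  define x where "x = (cnj (\<phi> u) / of_real ((norm u)\<^sup>2)) *\<^sub>C u"
  have "\<phi> h = cinner h x" if "h \<in> E" for h
  proof -
    have "\<phi> u *\<^sub>C h - \<phi> h *\<^sub>C u \<in> C"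
      using bounded_op_diff[OF \<phi> E(2) sub(3)[OF that] sub(3)[OF u(1)]] that u(1) sub
      by (simp add: C_def sc)
    then have "cinner (\<phi> u *\<^sub>C h - \<phi> h *\<^sub>C u) u = 0"
      using p(2) cinner_eq_zero_commute unfolding u_def by blast
    then have "\<phi> u * cinner h u = \<phi> h * of_real ((norm u)\<^sup>2)"
      by (simp add: cinner_diff_left cinner_scaleC_left cinner_self)
    then show ?thesis
      using u0 by (simp add: x_def cinner_scaleC_right field_simps)
  qed
  then show ?thesis using sub(3)[OF u(1)] x_def by blast
qed

lemma adjoint_op:
  fixes E :: "'e::{complex_inner,complete_space} set"
  assumes E: "closed E" "csubspace E" and T: "bounded_op E E T"
  shows "adjoint_op E T y \<in> E" "h \<in> E \<Longrightarrow> cinner (T h) y = cinner h (adjoint_op E T y)"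
proof -
  obtain K where K: "\<And>x. x \<in> E \<Longrightarrow> norm (T x) \<le> K * norm x"
    using bounded_op_bound[OF T] by blast
  have "\<forall>h\<in>E. norm (cinner (T h) y) \<le> (K * norm y) * norm h"
  proof
    fix h assume h: "h \<in> E"
    have "norm (cinner (T h) y) \<le> norm (T h) * norm y" by (rule cmod_cinner_le)
    also have "\<dots> \<le> K * norm h * norm y" by (intro mult_right_mono K h) simp
    finally show "norm (cinner (T h) y) \<le> (K * norm y) * norm h" by (simp add: mult_ac)
  qed
  then have "bounded_op E UNIV (\<lambda>h. cinner (T h) y)"
    unfolding bounded_op_def
    by (auto simp: bounded_opD[OF T] cinner_add_left cinner_scaleC_left scaleC_complex_def)
  from riesz_representation[OF E this]
  obtain x where x: "x \<in> E" "\<forall>h\<in>E. cinner (T h) y = cinner h x" by blast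
  have "adjoint_op E T y = x"
    unfolding adjoint_op_def
  proof (rule the_equality)
    fix x' assume x': "x' \<in> E \<and> (\<forall>h\<in>E. cinner (T h) y = cinner h x')"
    show "x' = x"
    proof (rule cinner_eq_on_subspace[OF E(2)])
      fix k assume "k \<in> E"
      then have "cinner k x' = cinner k x" using x x' by metis
      then show "cinner x' k = cinner x k" by (metis cinner_commute)
    qed (use x x' in auto)
  qed (use x in auto)
  then show "adjoint_op E T y \<in> E" "h \<in> E \<Longrightarrow> cinner (T h) y = cinner h (adjoint_op E T y)"
    using x by auto
qed

lemma adjoint_op_left:
  fixes E :: "'e::{complex_inner,complete_space} set"
  assumes "closed E" "csubspace E" "bounded_op E E T" "h \<in> E"
  shows "cinner (adjoint_op E T y) h = cinner y (T h)"
  using adjoint_op(2)[OF assms, of y] cinner_commute by metis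

lemma bounded_op_adjoint_op:
  fixes E :: "'e::{complex_inner,complete_space} set"
  assumes E: "closed E" "csubspace E" and T: "bounded_op E E T"
  shows "bounded_op E E (adjoint_op E T)"
proof -
  note adj = adjoint_op(1)[OF E T] adjoint_op_left[OF E T]
  note sub = csubspaceD[OF E(2)]
  obtain K where K: "K > 0" "\<And>x. x \<in> E \<Longrightarrow> norm (T x) \<le> K * norm x"
    using bounded_op_bound[OF T] by blast
  have "norm (adjoint_op E T y) \<le> K * norm y" for y
  proof -
    let ?x = "adjoint_op E T y"
    have "(norm ?x)\<^sup>2 = cmod (cinner y (T ?x))"
      using adj(2)[OF adj(1), of y y] cinner_self[of ?x]
      by (metis abs_power2 norm_of_real)
    also have "\<dots> \<le> norm y * norm (T ?x)" by (rule cmod_cinner_le)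
    also have "\<dots> \<le> norm y * (K * norm ?x)" by (intro mult_left_mono K adj) simp
    finally have "norm ?x * norm ?x \<le> (K * norm y) * norm ?x"
      by (simp add: power2_eq_square mult_ac)
    then show ?thesis using K(1) by (cases "norm ?x = 0") auto
  qed
  moreover have "adjoint_op E T (x + y) = adjoint_op E T x + adjoint_op E T y" for x y
    by (rule cinner_eq_on_subspace[OF E(2)]) (simp_all add: adj sub cinner_add_left)
  moreover have "adjoint_op E T (a *\<^sub>C x) = a *\<^sub>C adjoint_op E T x" for a x
    by (rule cinner_eq_on_subspace[OF E(2)]) (simp_all add: adj sub cinner_scaleC_left)
  ultimately show ?thesis unfolding bounded_op_def using adj(1) by blast
qed

lemma adjoint_op_unique:
  fixes E :: "'e::{complex_inner,complete_space} set"
  assumes "closed E" "csubspace E" "bounded_op E E T" "x \<in> E" "\<And>h. h \<in> E \<Longrightarrow> cinner x h = cinner y (T h)"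
  shows "adjoint_op E T y = x"
  by (rule cinner_eq_on_subspace[OF assms(2)])
    (simp_all add: assms adjoint_op(1)[OF assms(1-3)] adjoint_op_left[OF assms(1-3)])

text \<open>
  By homogeneity, a bound on the unit ball is a bound of the quadratic form on all of \<open>E\<close>.
\<close>

lemma numerical_radius_le_1_iff:
  assumes E: "csubspace E" and T: "bounded_op E E T"
  shows "numerical_radius E T \<le> 1 \<longleftrightarrow> (\<forall>h\<in>E. cmod (cinner (T h) h) \<le> (norm h)\<^sup>2)"
proof
  note sub = csubspaceD[OF E]
  obtain K where K: "K > 0" "\<And>x. x \<in> E \<Longrightarrow> norm (T x) \<le> K * norm x"
    using bounded_op_bound[OF T] by blast
  assume le: "numerical_radius E T \<le> 1"
  have bdd: "bdd_above ((\<lambda>h. cmod (cinner (T h) h)) ` {h\<in>E. norm h \<le> 1})"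
  proof (rule bdd_aboveI2)
    fix h assume "h \<in> {h\<in>E. norm h \<le> 1}"
    then have "norm (T h) \<le> K" "norm h \<le> 1"
      using K(2)[of h] mult_left_mono[of "norm h" 1 K] K(1) by (auto intro: order_trans)
    then have "norm (T h) * norm h \<le> K * 1" using K(1) by (intro mult_mono) auto
    then show "cmod (cinner (T h) h) \<le> K" using cmod_cinner_le[of "T h" h] by simp
  qed
  show "\<forall>h\<in>E. cmod (cinner (T h) h) \<le> (norm h)\<^sup>2"
  proof
    fix h assume h: "h \<in> E"
    show "cmod (cinner (T h) h) \<le> (norm h)\<^sup>2"
    proof (cases "h = 0")
      case False
      define g where "g = complex_of_real (1 / norm h) *\<^sub>C h"
      have g: "g \<in> E" "norm g = 1" using h sub False by (simp_all add: g_def norm_scaleC norm_divide)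
      have "cmod (cinner (T g) g) \<le> numerical_radius E T"
        unfolding numerical_radius_def by (rule cSUP_upper) (use g bdd in auto)
      then have "cmod (cinner (T g) g) \<le> 1" using le by linarith
      moreover have "cinner (T g) g = cinner (T h) h / of_real ((norm h)\<^sup>2)"
        by (simp add: g_def bounded_opD[OF T] h cinner_scaleC_left cinner_scaleC_right power2_eq_square)
      ultimately show ?thesis using False by (simp add: norm_divide norm_power divide_le_eq)
    qed simp
  qed
next
  assume le: "\<forall>h\<in>E. cmod (cinner (T h) h) \<le> (norm h)\<^sup>2"
  show "numerical_radius E T \<le> 1"
    unfolding numerical_radius_def
  proof (rule cSUP_least)
    show "{h \<in> E. norm h \<le> 1} \<noteq> {}" using csubspaceD(1)[OF E] by auto
    fix h assume "h \<in> {h \<in> E. norm h \<le> 1}"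
    then show "cmod (cinner (T h) h) \<le> 1"
      using le power_le_one[of "norm h" 2] by fastforce
  qed
qed

text \<open>
  The inner product of a complex space is determined by its norm (polarisation), so a linear
  isometry between subspaces preserves it.
\<close>

lemma isometry_cinner:
  assumes E: "csubspace E" "x \<in> E" "y \<in> E"
    and add: "\<And>x y. x \<in> E \<Longrightarrow> y \<in> E \<Longrightarrow> T (x + y) = T x + T y"
    and scale: "\<And>a x. x \<in> E \<Longrightarrow> T (a *\<^sub>C x) = a *\<^sub>C T x"
    and norm: "\<And>x. x \<in> E \<Longrightarrow> norm (T x) = norm x"
  shows "cinner (T x) (T y) = cinner x y"
proof -
  note sub = csubspaceD[OF E(1)]
  have re: "inner (T x) (T y) = inner x y" if "x \<in> E" "y \<in> E" for x y
  proof -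
    have eq: "inner a b = ((norm (a + b))\<^sup>2 - (norm a)\<^sup>2 - (norm b)\<^sup>2) / 2" for a b :: "'c::real_inner"
      unfolding power2_norm_eq_inner by (simp add: inner_add_left inner_add_right inner_commute)
    show ?thesis using add[OF that] norm[OF that(1)] norm[OF that(2)] norm[OF sub(2)[OF that]]
      by (simp add: eq)
  qed
  have im: "Im (cinner a b) = inner a (\<i> *\<^sub>C b)" for a b :: "'c::complex_inner"
    by (simp add: inner_eq_Re_cinner cinner_scaleC_right)
  show ?thesis
    using re[OF E(2,3)] re[OF E(2) sub(3)[OF E(3)], of \<i>] scale[OF E(3), of \<i>]
    by (intro complex_eqI) (simp_all add: inner_eq_Re_cinner[symmetric] im)
qed

lemma closed_isometric_image:
  fixes T :: "'a::{complex_inner,complete_space} \<Rightarrow> 'b::complex_inner"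
  assumes E: "csubspace E" "closed E"
    and diff: "\<And>x y. x \<in> E \<Longrightarrow> y \<in> E \<Longrightarrow> T (x - y) = T x - T y"
    and norm: "\<And>x. x \<in> E \<Longrightarrow> norm (T x) = norm x"
  shows "closed (T ` E)"
  unfolding closed_sequential_limits
proof (intro allI impI, elim conjE)
  fix y l assume y: "\<forall>n. y n \<in> T ` E" "y \<longlonglongrightarrow> l"
  then have "\<forall>n. \<exists>x\<in>E. y n = T x" by blast
  then obtain x where x: "\<And>n. x n \<in> E" "\<And>n. y n = T (x n)" by metis
  have dist: "dist (T u) (T v) = dist u v" if "u \<in> E" "v \<in> E" for u v
    using diff[OF that] norm[OF csubspaceD(4)[OF E(1) that]] by (simp add: dist_norm)
  have "Cauchy y" using y(2) LIMSEQ_imp_Cauchy by blast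
  then have "Cauchy x" unfolding Cauchy_def using dist x by simp
  then obtain p where p: "x \<longlonglongrightarrow> p" using Cauchy_convergent_iff convergent_def by blast
  have pE: "p \<in> E" by (rule closed_sequentially[OF E(2) x(1) p])
  have "y \<longlonglongrightarrow> T p"
    using p unfolding tendsto_dist_iff[of _ "T p"] tendsto_dist_iff[of _ p] x(2)
    by (simp add: dist x(1) pE)
  then show "l \<in> T ` E" using y(2) pE LIMSEQ_unique by blast
qed

section \<open>Coefficients, shift and point evaluation on the Hardy space\<close>

lift_definition h2_const :: "'a::complex_inner \<Rightarrow> 'a h2" is "\<lambda>h n. if n = 0 then h else 0"
  by (rule summable_finite[of "{0}"]) auto

lift_definition shift :: "'a::complex_inner h2 \<Rightarrow> 'a h2"
  is "\<lambda>f n. case n of 0 \<Rightarrow> 0 | Suc m \<Rightarrow> f m"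
  by (subst summable_Suc_iff[symmetric]) simp

lemma h2_coeff_simps [simp]:
  "h2_coeff 0 n = 0"
  "h2_coeff (f + g) n = h2_coeff f n + h2_coeff g n"
  "h2_coeff (f - g) n = h2_coeff f n - h2_coeff g n"
  "h2_coeff (a *\<^sub>C f) n = a *\<^sub>C h2_coeff f n"
  "h2_coeff (r *\<^sub>R f) n = r *\<^sub>R h2_coeff f n"
  "h2_coeff (h2_const h) n = (if n = 0 then h else 0)"
  "h2_coeff (shift f) 0 = 0"
  "h2_coeff (shift f) (Suc n) = h2_coeff f n"
  by (transfer, simp)+

lemma h2_eqI: "(\<And>n. h2_coeff f n = h2_coeff g n) \<Longrightarrow> f = g"
  by (simp add: h2_coeff_inject[symmetric] ext)

lemma h2_eqI_Suc:
  "h2_coeff f 0 = h2_coeff g 0 \<Longrightarrow> (\<And>n. h2_coeff f (Suc n) = h2_coeff g (Suc n)) \<Longrightarrow> f = g"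
  by (rule h2_eqI) (metis not0_implies_Suc)

lemma h2_coeff_Abs_h2:
  "summable (\<lambda>n. (norm (f n))\<^sup>2) \<Longrightarrow> h2_coeff (Abs_h2 f) n = f n"
  by (simp add: Abs_h2_inverse)

lemma h2_cinner_sums: "(\<lambda>n. cinner (h2_coeff f n) (h2_coeff g n)) sums cinner f g"
  unfolding cinner_h2.rep_eq
  by (rule summable_sums) (intro h2_cinner_summable h2_coeff_summable)

lemma h2_norm_sums: "(\<lambda>n. (norm (h2_coeff f n))\<^sup>2) sums (norm f)\<^sup>2"
  using summable_sums[OF h2_coeff_summable[of f]] suminf_nonneg[OF h2_coeff_summable[of f]]
  by (simp add: norm_h2)

lemma norm_h2_coeff_le: "norm (h2_coeff f n) \<le> norm f"
proof (rule power2_le_imp_le)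
  have "(norm (h2_coeff f n))\<^sup>2 \<le> (\<Sum>k<Suc n. (norm (h2_coeff f k))\<^sup>2)"
    by (rule member_le_sum) auto
  then show "(norm (h2_coeff f n))\<^sup>2 \<le> (norm f)\<^sup>2"
    using h2_partial_sum_le[of f "Suc n"] by linarith
qed simp

lemma bounded_linear_h2_coeff: "bounded_linear (\<lambda>f. h2_coeff f n)"
  by (rule bounded_linear_intro[of _ 1]) (simp_all add: norm_h2_coeff_le)

lemma shift_add: "shift (f + g) = shift f + shift g"
  and shift_diff: "shift (f - g) = shift f - shift g"
  and shift_scaleC: "shift (a *\<^sub>C f) = a *\<^sub>C shift f"
  and shift_zero [simp]: "shift 0 = 0"
  by (rule h2_eqI_Suc; simp)+

lemma cinner_shift_shift [simp]: "cinner (shift f) (shift g) = cinner f g"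
proof -
  have "(\<lambda>n. cinner (h2_coeff (shift f) n) (h2_coeff (shift g) n)) sums cinner f g"
    using sums_Suc[of "\<lambda>n. cinner (h2_coeff (shift f) n) (h2_coeff (shift g) n)" "cinner f g"]
    by (simp add: h2_cinner_sums)
  then show ?thesis using h2_cinner_sums sums_unique2 by blast
qed

lemma norm_shift [simp]: "norm (shift f) = norm f"
  by (simp add: norm_eq_sqrt_inner inner_eq_Re_cinner)

lemma cinner_shift_const: "cinner (shift f) (h2_const k) = 0"
proof -
  have "(\<lambda>n. cinner (h2_coeff (shift f) n) (h2_coeff (h2_const k) n)) = (\<lambda>n. 0)"
  proof
    show "cinner (h2_coeff (shift f) n) (h2_coeff (h2_const k) n) = 0" for n
      by (cases n) simp_all
  qed
  then show ?thesis using h2_cinner_sums[of "shift f" "h2_const k"] by (simp add: sums_iff)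
qed

lemma h2_eq_const_plus_shift: "\<exists>g. f = h2_const (h2_coeff f 0) + shift g \<and> (\<forall>n. h2_coeff g n = h2_coeff f (Suc n))"
proof -
  have "summable (\<lambda>n. (norm (h2_coeff f (Suc n)))\<^sup>2)"
    by (subst summable_Suc_iff) (rule h2_coeff_summable)
  then have c: "h2_coeff (Abs_h2 (\<lambda>n. h2_coeff f (Suc n))) n = h2_coeff f (Suc n)" for n
    by (rule h2_coeff_Abs_h2)
  have "f = h2_const (h2_coeff f 0) + shift (Abs_h2 (\<lambda>n. h2_coeff f (Suc n)))"
    by (rule h2_eqI_Suc) (simp_all add: c)
  then show ?thesis using c by blast
qed

lemma h2_coeff_shift_power:
  "h2_coeff ((shift ^^ n) f) m = (if m < n then 0 else h2_coeff f (m - n))"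
proof (induction n arbitrary: m)
  case (Suc n)
  then show ?case by (cases m) simp_all
qed simp

lemma shift_power_add: "(shift ^^ n) (f + g) = (shift ^^ n) f + (shift ^^ n) g"
  by (rule h2_eqI) (simp add: h2_coeff_shift_power)

lemma cinner_shift_power [simp]: "cinner ((shift ^^ n) f) ((shift ^^ n) g) = cinner f g"
  by (induction n) simp_all

lemma norm_shift_power [simp]: "norm ((shift ^^ n) f) = norm f"
  by (induction n) simp_all

lemma cinner_shift_power_const: "cinner f ((shift ^^ n) (h2_const k)) = cinner (h2_coeff f n) k"
proof -
  have "(\<lambda>m. cinner (h2_coeff f m) (h2_coeff ((shift ^^ n) (h2_const k)) m)) sums cinner (h2_coeff f n) k"
    using sums_single[of n "\<lambda>m. cinner (h2_coeff f m) k"]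
    by (rule back_subst[of "\<lambda>s. s sums _"]) (auto simp: h2_coeff_shift_power)
  then show ?thesis using h2_cinner_sums sums_unique2 by blast
qed

lemma h2_const_add: "h2_const (x + y) = h2_const x + h2_const y"
  and h2_const_scaleC: "h2_const (a *\<^sub>C x) = a *\<^sub>C h2_const x"
  by (rule h2_eqI; simp)+

lemma norm_h2_const [simp]: "norm (h2_const x) = norm x"
proof -
  have "cinner (h2_const x) (h2_const x) = cinner x x"
    using cinner_shift_power_const[of "h2_const x" 0 x] by simp
  then show ?thesis by (simp add: norm_eq_sqrt_inner inner_eq_Re_cinner)
qed

lemma csubspace_H2: "csubspace E \<Longrightarrow> csubspace (H2 E)"
  unfolding complex_vector.subspace_def H2_def by simp

lemma H2_coeff: "f \<in> H2 E \<Longrightarrow> h2_coeff f n \<in> E"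
  by (simp add: H2_def)

lemma shift_in_H2: "csubspace E \<Longrightarrow> f \<in> H2 E \<Longrightarrow> shift f \<in> H2 E"
  unfolding H2_def
proof safe
  fix n assume "csubspace E" "\<forall>n. h2_coeff f n \<in> E"
  then show "h2_coeff (shift f) n \<in> E" by (cases n) (simp_all add: csubspaceD(1))
qed

lemma h2_const_in_H2: "csubspace E \<Longrightarrow> h \<in> E \<Longrightarrow> h2_const h \<in> H2 E"
  by (simp add: H2_def csubspaceD(1))

section \<open>Point evaluation and the reproducing kernel\<close>

text \<open>The Taylor coefficients of \<open>\<zeta> \<mapsto> k / (1 - \<zeta> cnj z)\<close>.\<close>

definition szego_kernel :: "complex \<Rightarrow> 'a::complex_inner \<Rightarrow> 'a h2"
  where "szego_kernel z k = Abs_h2 (\<lambda>n. cnj z ^ n *\<^sub>C k)"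

lemma cmod_power2_less_1: "cmod z < 1 \<Longrightarrow> (cmod z)\<^sup>2 < 1"
  by (simp add: power_less_one_iff abs_square_less_1)

lemma h2_coeff_szego_kernel:
  assumes "cmod z < 1"
  shows "h2_coeff (szego_kernel z k) n = cnj z ^ n *\<^sub>C k"
    and "(norm (szego_kernel z k))\<^sup>2 = (norm k)\<^sup>2 / (1 - (cmod z)\<^sup>2)"
proof -
  have eq: "(\<lambda>n. (norm (cnj z ^ n *\<^sub>C k))\<^sup>2) = (\<lambda>n. ((cmod z)\<^sup>2) ^ n * (norm k)\<^sup>2)"
    by (simp add: norm_scaleC norm_power power_mult_distrib power_mult[symmetric] mult.commute)
  have s: "(\<lambda>n. (norm (cnj z ^ n *\<^sub>C k))\<^sup>2) sums (1 / (1 - (cmod z)\<^sup>2) * (norm k)\<^sup>2)"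
    unfolding eq by (intro sums_mult2 geometric_sums) (simp add: cmod_power2_less_1 assms)
  then show c: "h2_coeff (szego_kernel z k) n = cnj z ^ n *\<^sub>C k" for n
    unfolding szego_kernel_def by (intro h2_coeff_Abs_h2) (rule sums_summable)
  show "(norm (szego_kernel z k))\<^sup>2 = (norm k)\<^sup>2 / (1 - (cmod z)\<^sup>2)"
    using h2_norm_sums[of "szego_kernel z k"] s unfolding c by (simp add: sums_unique2)
qed

lemma h2_eval_sums:
  fixes f :: "'a::{complex_inner,complete_space} h2"
  assumes "cmod z < 1"
  shows "(\<lambda>n. z ^ n *\<^sub>C h2_coeff f n) sums h2_eval f z"
  unfolding h2_eval_def
proof (rule summable_sums, rule absolutely_summable_imp_summable)
  show "summable (\<lambda>n. norm (z ^ n *\<^sub>C h2_coeff f n))"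
  proof (rule summable_comparison_test')
    show "summable (\<lambda>n. cmod z ^ n * norm f)"
      using assms by (intro summable_mult2 summable_geometric) simp
    show "norm (norm (z ^ n *\<^sub>C h2_coeff f n)) \<le> cmod z ^ n * norm f" for n
      by (simp add: norm_scaleC norm_power mult_left_mono norm_h2_coeff_le)
  qed
qed

lemma cinner_szego_kernel:
  fixes f :: "'a::{complex_inner,complete_space} h2"
  assumes "cmod z < 1"
  shows "cinner f (szego_kernel z k) = cinner (h2_eval f z) k"
proof -
  have "(\<lambda>n. cinner (z ^ n *\<^sub>C h2_coeff f n) k) sums cinner (h2_eval f z) k"
    by (rule bounded_linear.sums[OF bounded_linear_cinner_left h2_eval_sums[OF assms]])
  moreover have "(\<lambda>n. cinner (z ^ n *\<^sub>C h2_coeff f n) k)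
      = (\<lambda>n. cinner (h2_coeff f n) (h2_coeff (szego_kernel z k) n))"
    by (simp add: h2_coeff_szego_kernel[OF assms] cinner_scaleC_left cinner_scaleC_right)
  ultimately show ?thesis using h2_cinner_sums sums_unique2 by metis
qed

text \<open>
  The square of the norm of \<open>f z\<close> is the inner product of \<open>f\<close> with the kernel at \<open>z\<close> in the direction
  of \<open>f z\<close>, so the Cauchy-Schwarz inequality applies.
\<close>

lemma norm_h2_eval_le:
  fixes f :: "'a::{complex_inner,complete_space} h2"
  assumes z: "cmod z < 1"
  shows "(norm (h2_eval f z))\<^sup>2 \<le> (norm f)\<^sup>2 / (1 - (cmod z)\<^sup>2)"
proof (cases "h2_eval f z = 0")
  case True
  then show ?thesis using cmod_power2_less_1[OF z] by simp
next
  case False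
  define v where "v = h2_eval f z"
  have "cinner f (szego_kernel z v) = of_real ((norm v)\<^sup>2)"
    by (simp only: cinner_szego_kernel[OF z] v_def cinner_self)
  then have "(norm v)\<^sup>2 \<le> norm f * norm (szego_kernel z v)"
    using cmod_cinner_le[of f "szego_kernel z v"] by (simp add: norm_power)
  then have "((norm v)\<^sup>2)\<^sup>2 \<le> (norm f * norm (szego_kernel z v))\<^sup>2" by (intro power_mono) auto
  also have "\<dots> = ((norm f)\<^sup>2 / (1 - (cmod z)\<^sup>2)) * (norm v)\<^sup>2"
    by (simp add: power_mult_distrib h2_coeff_szego_kernel[OF z])
  finally have "(norm v)\<^sup>2 * (norm v)\<^sup>2 \<le> ((norm f)\<^sup>2 / (1 - (cmod z)\<^sup>2)) * (norm v)\<^sup>2"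
    by (simp add: power2_eq_square)
  then have "(norm v)\<^sup>2 \<le> (norm f)\<^sup>2 / (1 - (cmod z)\<^sup>2)"
    by (rule mult_right_le_imp_le) (use False in \<open>simp add: v_def\<close>)
  then show ?thesis by (simp add: v_def)
qed

lemma h2_eval_add:
  fixes f :: "'a::{complex_inner,complete_space} h2"
  assumes z: "cmod z < 1"
  shows "h2_eval (f + g) z = h2_eval f z + h2_eval g z"
  using sums_add[OF h2_eval_sums[OF z, of f] h2_eval_sums[OF z, of g]] h2_eval_sums[OF z, of "f + g"]
  by (simp add: scaleC_add_right sums_unique2)

lemma h2_eval_scaleC:
  fixes f :: "'a::{complex_inner,complete_space} h2"
  assumes z: "cmod z < 1"
  shows "h2_eval (a *\<^sub>C f) z = a *\<^sub>C h2_eval f z"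
proof -
  have "(\<lambda>n. a *\<^sub>C z ^ n *\<^sub>C h2_coeff f n) sums (a *\<^sub>C h2_eval f z)"
    by (rule bounded_linear.sums[OF bounded_linear_scaleC h2_eval_sums[OF z]])
  then show ?thesis
    using h2_eval_sums[OF z, of "a *\<^sub>C f"]
    by (simp add: scaleC_scaleC mult.commute sums_unique2)
qed

lemma bounded_linear_h2_eval:
  fixes z :: complex
  assumes z: "cmod z < 1"
  shows "bounded_linear (\<lambda>f :: 'a::{complex_inner,complete_space} h2. h2_eval f z)"
proof (rule bounded_linear_intro[of _ "1 / sqrt (1 - (cmod z)\<^sup>2)"])
  fix f g :: "'a h2" and r :: real
  show "h2_eval (f + g) z = h2_eval f z + h2_eval g z" by (rule h2_eval_add[OF z])
  show "h2_eval (r *\<^sub>R f) z = r *\<^sub>R h2_eval f z"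
    using h2_eval_scaleC[OF z, of "of_real r" f] by (simp add: scaleC_of_real)
  show "norm (h2_eval f z) \<le> norm f * (1 / sqrt (1 - (cmod z)\<^sup>2))"
  proof (rule power2_le_imp_le)
    show "(norm (h2_eval f z))\<^sup>2 \<le> (norm f * (1 / sqrt (1 - (cmod z)\<^sup>2)))\<^sup>2"
      using norm_h2_eval_le[OF z, of f] cmod_power2_less_1[OF z]
      by (simp add: power_mult_distrib power_divide)
  qed (use cmod_power2_less_1[OF z] in simp)
qed

lemma h2_eval_diff:
  fixes f :: "'a::{complex_inner,complete_space} h2"
  assumes z: "cmod z < 1"
  shows "h2_eval (f - g) z = h2_eval f z - h2_eval g z"
  using linear_diff[OF bounded_linear.linear[OF bounded_linear_h2_eval[OF z]], of f g] by simp

lemma h2_eval_const [simp]: "h2_eval (h2_const h) z = h"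
proof -
  have "(\<lambda>n. z ^ n *\<^sub>C h2_coeff (h2_const h) n) sums h"
    using sums_single[of 0 "\<lambda>_. h"]
    by (rule back_subst[of "\<lambda>s. s sums _"]) (auto simp: scaleC_one)
  then show ?thesis unfolding h2_eval_def by (simp add: sums_iff)
qed

lemma h2_eval_shift:
  fixes f :: "'a::{complex_inner,complete_space} h2"
  assumes z: "cmod z < 1"
  shows "h2_eval (shift f) z = z *\<^sub>C h2_eval f z"
proof -
  have "(\<lambda>n. z *\<^sub>C z ^ n *\<^sub>C h2_coeff f n) sums (z *\<^sub>C h2_eval f z)"
    by (rule bounded_linear.sums[OF bounded_linear_scaleC h2_eval_sums[OF z]])
  then have "(\<lambda>n. z ^ Suc n *\<^sub>C h2_coeff (shift f) (Suc n)) sums (z *\<^sub>C h2_eval f z)"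
    by (simp add: scaleC_scaleC)
  then have "(\<lambda>n. z ^ n *\<^sub>C h2_coeff (shift f) n) sums (z *\<^sub>C h2_eval f z)"
    by (subst (asm) sums_Suc_iff) simp
  then show ?thesis using h2_eval_sums[OF z] sums_unique2 by blast
qed

lemma h2_eval_shift_power:
  fixes f :: "'a::{complex_inner,complete_space} h2"
  assumes z: "cmod z < 1"
  shows "h2_eval ((shift ^^ n) f) z = z ^ n *\<^sub>C h2_eval f z"
  by (induction n) (simp_all add: h2_eval_shift[OF z] scaleC_scaleC scaleC_one)

lemma h2_eval_szego_kernel:
  fixes k :: "'a::{complex_inner,complete_space}"
  assumes z: "cmod z < 1"
  shows "h2_eval (szego_kernel z k) z = complex_of_real (1 / (1 - (cmod z)\<^sup>2)) *\<^sub>C k"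
proof -
  have "(\<lambda>n. ((cmod z)\<^sup>2) ^ n *\<^sub>R k) sums ((1 / (1 - (cmod z)\<^sup>2)) *\<^sub>R k)"
    by (intro bounded_linear.sums[OF bounded_linear_scaleR_left] geometric_sums)
      (simp add: cmod_power2_less_1 z)
  moreover have "((cmod z)\<^sup>2) ^ n *\<^sub>R k = z ^ n *\<^sub>C h2_coeff (szego_kernel z k) n" for n
    by (simp add: h2_coeff_szego_kernel[OF z] scaleC_scaleC power_mult_distrib[symmetric]
        scaleC_of_real[symmetric] complex_norm_square[symmetric])
  ultimately show ?thesis
    using h2_eval_sums[OF z, of "szego_kernel z k"] by (simp add: sums_unique2 scaleC_of_real del: of_real_divide of_real_diff of_real_power)
qed

text \<open>
  A nonzero element has a first nonzero coefficient; dividing by the corresponding power of \<open>z\<close>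
  leaves a power series whose limit at the origin is that coefficient.
\<close>

lemma h2_eval_eq_zeroD:
  fixes f :: "'a::{complex_inner,complete_space} h2"
  assumes "\<And>z. cmod z < 1 \<Longrightarrow> h2_eval f z = 0"
  shows "f = 0"
proof (rule ccontr)
  assume "f \<noteq> 0"
  then obtain m where "h2_coeff f m \<noteq> 0" using h2_eqI[of f 0] by auto
  then obtain n where n: "h2_coeff f n \<noteq> 0" and min: "\<And>m. m < n \<Longrightarrow> h2_coeff f m = 0"
    using exists_least_iff[of "\<lambda>m. h2_coeff f m \<noteq> 0"] by blast
  define k where "k = h2_coeff f n"
  define a where "a i = cinner (h2_coeff f (i + n)) k" for i
  have "(\<lambda>i. a i * z ^ i) sums 0" if z: "z \<noteq> 0" "norm z < 1" for z
  proof -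
    have "(\<lambda>i. cinner (z ^ i *\<^sub>C h2_coeff f i) k) sums cinner (h2_eval f z) k"
      by (rule bounded_linear.sums[OF bounded_linear_cinner_left h2_eval_sums[OF z(2)]])
    then have "(\<lambda>i. z ^ i * cinner (h2_coeff f i) k) sums 0"
      using assms[OF z(2)] by (simp add: cinner_scaleC_left)
    then have "(\<lambda>i. z ^ (i + n) * a i) sums 0"
      unfolding a_def using sums_zero_iff_shift[of n "\<lambda>i. z ^ i * cinner (h2_coeff f i) k" 0]
      by (simp add: min)
    then have "(\<lambda>i. (1 / z ^ n) * (z ^ (i + n) * a i)) sums ((1 / z ^ n) * 0)"
      by (rule sums_mult)
    then show ?thesis using z(1) by (simp add: power_add mult.commute)
  qed
  then have "(\<lambda>_. 0) \<midarrow>(0::complex)\<rightarrow> a 0"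
    using powser_limit_0_strong[of 1 a "\<lambda>_. 0"] by simp
  then have "a 0 = 0" using LIM_const_eq by metis
  then show False using n by (simp add: a_def k_def)
qed

text \<open>
  The values in the disc determine an element, so a candidate that has the required values is the
  product.
\<close>

lemma mult_op_eqI:
  fixes g :: "'f::{complex_inner,complete_space} h2"
  assumes "\<And>z. cmod z < 1 \<Longrightarrow> h2_eval g z = \<Phi> z (h2_eval f z)"
  shows "mult_op \<Phi> f = g"
  unfolding mult_op_def
proof (rule the_equality)
  show "\<forall>z\<in>ball 0 1. h2_eval g z = \<Phi> z (h2_eval f z)" using assms by simp
  fix g' :: "'f h2" assume "\<forall>z\<in>ball 0 1. h2_eval g' z = \<Phi> z (h2_eval f z)"
  then have "g' - g = 0" by (intro h2_eval_eq_zeroD) (simp add: h2_eval_diff assms)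
  then show "g' = g" by simp
qed

lemma M_z_eq_shift: "M_z = (shift :: 'a::{complex_inner,complete_space} h2 \<Rightarrow> _)"
  unfolding M_z_def by (rule ext) (simp add: mult_op_eqI h2_eval_shift)

lemma h2_eval_in:
  fixes E :: "'a::{complex_inner,complete_space} set"
  assumes "closed E" "csubspace E" "f \<in> H2 E" "cmod z < 1"
  shows "h2_eval f z \<in> E"
proof (rule closed_sequentially[OF assms(1)])
  show "(\<Sum>n<N. z ^ n *\<^sub>C h2_coeff f n) \<in> E" for N
    by (intro csubspaceD[OF assms(2)] H2_coeff assms)
  show "(\<lambda>N. \<Sum>n<N. z ^ n *\<^sub>C h2_coeff f n) \<longlonglongrightarrow> h2_eval f z"
    using h2_eval_sums[OF assms(4)] by (simp add: sums_def)
qed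

section \<open>Coefficientwise operators\<close>

definition h2_map :: "('e::complex_inner \<Rightarrow> 'f::complex_inner) \<Rightarrow> 'e h2 \<Rightarrow> 'f h2"
  where "h2_map T f = Abs_h2 (\<lambda>n. T (h2_coeff f n))"

lemma h2_map:
  assumes T: "bounded_op E F T" and f: "f \<in> H2 E"
  shows "h2_coeff (h2_map T f) n = T (h2_coeff f n)" "h2_map T f \<in> H2 F"
proof -
  obtain K where K: "K > 0" "\<And>x. x \<in> E \<Longrightarrow> norm (T x) \<le> K * norm x"
    using bounded_op_bound[OF T] by blast
  have "summable (\<lambda>n. (norm (T (h2_coeff f n)))\<^sup>2)"
  proof (rule summable_comparison_test')
    show "summable (\<lambda>n. K\<^sup>2 * (norm (h2_coeff f n))\<^sup>2)" by (intro summable_mult h2_coeff_summable)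
    show "norm ((norm (T (h2_coeff f n)))\<^sup>2) \<le> K\<^sup>2 * (norm (h2_coeff f n))\<^sup>2" for n
      using power_mono[OF K(2)[OF H2_coeff[OF f, of n]] norm_ge_zero, of 2]
      by (simp add: power_mult_distrib)
  qed
  then show c: "h2_coeff (h2_map T f) n = T (h2_coeff f n)" for n
    unfolding h2_map_def by (rule h2_coeff_Abs_h2)
  show "h2_map T f \<in> H2 F" unfolding H2_def using c bounded_opD(1)[OF T H2_coeff[OF f]] by simp
qed

lemma norm_h2_map_le:
  assumes f: "f \<in> H2 E" and T: "bounded_op E F T"
    and K: "K \<ge> 0" "\<And>x. x \<in> E \<Longrightarrow> norm (T x) \<le> K * norm x"
  shows "norm (h2_map T f) \<le> K * norm f"
proof (rule power2_le_imp_le)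
  have "(norm (h2_map T f))\<^sup>2 \<le> K\<^sup>2 * (norm f)\<^sup>2"
  proof (rule sums_le[OF _ h2_norm_sums sums_mult[OF h2_norm_sums]])
    show "(norm (h2_coeff (h2_map T f) n))\<^sup>2 \<le> K\<^sup>2 * (norm (h2_coeff f n))\<^sup>2" for n
      using power_mono[OF K(2)[OF H2_coeff[OF f, of n]] norm_ge_zero, of 2]
      by (simp add: power_mult_distrib h2_map(1)[OF T f])
  qed
  then show "(norm (h2_map T f))\<^sup>2 \<le> (K * norm f)\<^sup>2" by (simp add: power_mult_distrib)
qed (use K in simp)

lemma h2_eval_h2_map:
  fixes E :: "'e::{complex_inner,complete_space} set"
    and T :: "'e \<Rightarrow> 'f::{complex_inner,complete_space}"
  assumes E: "closed E" "csubspace E" and T: "bounded_op E F T" and f: "f \<in> H2 E"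
    and z: "cmod z < 1"
  shows "h2_eval (h2_map T f) z = T (h2_eval f z)"
proof -
  have "(\<lambda>n. T (z ^ n *\<^sub>C h2_coeff f n)) sums T (h2_eval f z)"
    by (rule bounded_op_sums(1)[OF T E _ h2_eval_sums[OF z]]) (intro csubspaceD[OF E(2)] H2_coeff f)
  then have "(\<lambda>n. z ^ n *\<^sub>C h2_coeff (h2_map T f) n) sums T (h2_eval f z)"
    by (simp add: h2_map(1)[OF T f] bounded_opD(3)[OF T H2_coeff[OF f]])
  then show ?thesis using h2_eval_sums[OF z] sums_unique2 by blast
qed

section \<open>The pencil of an operator\<close>

lemma h2_map_shift:
  assumes "csubspace E" "bounded_op E F T" "f \<in> H2 E"
  shows "h2_map T (shift f) = shift (h2_map T f)"
  by (rule h2_eqI_Suc)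
    (simp_all add: h2_map(1)[OF assms(2)] assms(3) shift_in_H2[OF assms(1)] bounded_op_zero[OF assms(2,1)])

lemma cinner_h2_map_adjoint_left:
  fixes E :: "'e::{complex_inner,complete_space} set"
  assumes E: "closed E" "csubspace E" and T: "bounded_op E E T" and fg: "f \<in> H2 E" "g \<in> H2 E"
  shows "cinner (h2_map (adjoint_op E T) f) g = cinner f (h2_map T g)"
proof -
  have "cinner (h2_coeff (h2_map (adjoint_op E T) f) n) (h2_coeff g n)
      = cinner (h2_coeff f n) (h2_coeff (h2_map T g) n)" for n
    by (simp add: h2_map(1)[OF T] h2_map(1)[OF bounded_op_adjoint_op[OF E T]] fg
        adjoint_op_left[OF E T] H2_coeff[OF fg(2)])
  then show ?thesis
    using h2_cinner_sums[of "h2_map (adjoint_op E T) f" g] h2_cinner_sums[of f "h2_map T g"]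
    by (simp add: sums_unique2)
qed

lemma cinner_h2_map_adjoint_right:
  fixes E :: "'e::{complex_inner,complete_space} set"
  assumes "closed E" "csubspace E" "bounded_op E E T" "f \<in> H2 E" "g \<in> H2 E"
  shows "cinner (h2_map T f) g = cinner f (h2_map (adjoint_op E T) g)"
  using cinner_h2_map_adjoint_left[OF assms(1-3,5,4)] by (metis cinner_commute)

context
  fixes E :: "'e::{complex_inner,complete_space} set" and T :: "'e \<Rightarrow> 'e"
  assumes E: "closed E" "csubspace E" and T: "bounded_op E E T"
begin

lemma h2_eval_pencil:
  assumes "f \<in> H2 E" "cmod z < 1"
  shows "h2_eval (h2_map T f + shift (h2_map (adjoint_op E T) f)) z
    = T (h2_eval f z) + z *\<^sub>C adjoint_op E T (h2_eval f z)"
  by (simp add: h2_eval_add h2_eval_shift h2_eval_h2_map[OF E T]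
      h2_eval_h2_map[OF E bounded_op_adjoint_op[OF E T]] assms)

lemma M_pencil_eq:
  "f \<in> H2 E \<Longrightarrow> M_pencil E T f = h2_map T f + shift (h2_map (adjoint_op E T) f)"
  unfolding M_pencil_def by (rule mult_op_eqI) (rule h2_eval_pencil)

lemma h2_coeff_M_pencil:
  assumes "f \<in> H2 E"
  shows "h2_coeff (M_pencil E T f) 0 = T (h2_coeff f 0)"
    and "h2_coeff (M_pencil E T f) (Suc n) = T (h2_coeff f (Suc n)) + adjoint_op E T (h2_coeff f n)"
  by (simp_all add: M_pencil_eq assms h2_map(1)[OF T] h2_map(1)[OF bounded_op_adjoint_op[OF E T]])

lemma M_pencil_in_H2: "f \<in> H2 E \<Longrightarrow> M_pencil E T f \<in> H2 E"
  by (simp add: M_pencil_eq csubspaceD(2)[OF csubspace_H2[OF E(2)]] shift_in_H2[OF E(2)]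
      h2_map(2)[OF T] h2_map(2)[OF bounded_op_adjoint_op[OF E T]])

lemma bounded_op_M_pencil: "bounded_op (H2 E) (H2 E) (M_pencil E T)"
proof -
  note sub = csubspaceD[OF csubspace_H2[OF E(2)]]
  note T' = bounded_op_adjoint_op[OF E T]
  have "M_pencil E T (f + g) = M_pencil E T f + M_pencil E T g" if "f \<in> H2 E" "g \<in> H2 E" for f g
    by (rule h2_eqI_Suc)
      (simp_all add: h2_coeff_M_pencil that sub bounded_opD(2)[OF T] bounded_opD(2)[OF T'] H2_coeff)
  moreover have "M_pencil E T (a *\<^sub>C f) = a *\<^sub>C M_pencil E T f" if "f \<in> H2 E" for a f
    by (rule h2_eqI_Suc)
      (simp_all add: h2_coeff_M_pencil that sub bounded_opD(3)[OF T] bounded_opD(3)[OF T'] H2_coeff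
        scaleC_add_right)
  moreover have "\<exists>K. \<forall>f\<in>H2 E. norm (M_pencil E T f) \<le> K * norm f"
  proof -
    obtain K where K: "K > 0" "\<And>x. x \<in> E \<Longrightarrow> norm (T x) \<le> K * norm x"
      using bounded_op_bound[OF T] by blast
    obtain K' where K': "K' > 0" "\<And>x. x \<in> E \<Longrightarrow> norm (adjoint_op E T x) \<le> K' * norm x"
      using bounded_op_bound[OF T'] by blast
    have "norm (M_pencil E T f) \<le> (K + K') * norm f" if f: "f \<in> H2 E" for f
    proof -
      have "norm (M_pencil E T f) \<le> norm (h2_map T f) + norm (h2_map (adjoint_op E T) f)"
        using norm_triangle_ineq[of "h2_map T f" "shift (h2_map (adjoint_op E T) f)"]
        by (simp add: M_pencil_eq f)
      also have "\<dots> \<le> K * norm f + K' * norm f"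
        by (intro add_mono norm_h2_map_le[OF f T] norm_h2_map_le[OF f T'])
          (use K K' in auto)
      finally show ?thesis by (simp add: distrib_right)
    qed
    then show ?thesis by blast
  qed
  ultimately show ?thesis unfolding bounded_op_def using M_pencil_in_H2 by blast
qed

lemma M_pencil_shift:
  "f \<in> H2 E \<Longrightarrow> M_pencil E T (shift f) = shift (M_pencil E T f)"
  by (simp add: M_pencil_eq shift_in_H2[OF E(2)] shift_add h2_map_shift[OF E(2) T]
      h2_map_shift[OF E(2) bounded_op_adjoint_op[OF E T]])

text \<open>
  On the circle the symbol satisfies \<open>(A + A\<^sup>* z)\<^sup>* z = A + A\<^sup>* z\<close>.  This symmetry, which involves only
  the shift and inner products, survives every isometric intertwining; it is what forces the
  compression of a pencil to be a pencil again.
\<close>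

lemma M_pencil_symmetric:
  assumes f: "f \<in> H2 E" and g: "g \<in> H2 E"
  shows "cinner (M_pencil E T f) (shift g) = cinner f (M_pencil E T g)"
proof -
  note T' = bounded_op_adjoint_op[OF E T]
  have "cinner (h2_map T f) (shift g) = cinner f (shift (h2_map (adjoint_op E T) g))"
    by (simp add: cinner_h2_map_adjoint_right[OF E T f shift_in_H2[OF E(2) g]] h2_map_shift[OF E(2) T' g])
  moreover have "cinner (h2_map (adjoint_op E T) f) g = cinner f (h2_map T g)"
    by (rule cinner_h2_map_adjoint_left[OF E T f g])
  ultimately show ?thesis
    by (simp add: M_pencil_eq f g cinner_add_left cinner_add_right)
qed

end

section \<open>The numerical radius and the quadratic form of the pencil\<close>

lemma sum_cis_roots_of_unity:
  fixes d :: int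
  assumes "M > 0" "\<bar>d\<bar> < int M"
  shows "(\<Sum>m<M. cis (2 * pi * real m * of_int d / real M)) = (if d = 0 then of_nat M else 0)"
proof (cases "d = 0")
  case False
  define q where "q = cis (2 * pi * of_int d / real M)"
  have "q \<noteq> 1"
  proof
    assume "q = 1"
    then obtain n :: int where "2 * pi * of_int d / real M = of_int n * (2 * pi)"
      unfolding q_def cis_eq_1_iff by blast
    then have "real_of_int d = of_int n * real M"
      using assms(1) by (simp add: field_simps)
    then have "d = n * int M" by (metis of_int_eq_iff of_int_mult of_int_of_nat_eq)
    then have "int M dvd \<bar>d\<bar>" by simp
    then show False using assms False zdvd_imp_le[of "int M" "\<bar>d\<bar>"] by auto
  qed
  moreover have "q ^ M = 1"
  proof -
    have "q ^ M = cis (real M * (2 * pi * of_int d / real M))" unfolding q_def by (rule Complex.DeMoivre)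
    also have "real M * (2 * pi * of_int d / real M) = 2 * pi * of_int d" using assms(1) by simp
    finally show ?thesis by simp
  qed
  moreover have "cis (2 * pi * real m * of_int d / real M) = q ^ m" for m
    by (simp add: q_def Complex.DeMoivre mult_ac)
  ultimately show ?thesis using False by (simp add: geometric_sum)
qed simp

text \<open>
  The bound \<open>|\<langle>T h, h\<rangle>| \<le> \<parallel>h\<parallel>\<^sup>2\<close> applied to the trigonometric polynomial \<open>F(\<omega>) = \<Sum> \<omega>\<^sup>j x\<^sub>j\<close> at the
  roots of unity \<open>\<omega>\<close>, weighted with \<open>\<omega>\<close> and averaged, isolates the products of consecutive entries.
\<close>

lemma sum_consecutive_cinner_le:
  fixes T :: "'e::complex_inner \<Rightarrow> 'e"
  assumes E: "csubspace E" and T: "bounded_op E E T"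
    and nr: "\<And>h. h \<in> E \<Longrightarrow> cmod (cinner (T h) h) \<le> (norm h)\<^sup>2"
    and x: "\<And>j. x j \<in> E"
  shows "cmod (\<Sum>j<N. cinner (T (x j)) (x (Suc j))) \<le> (\<Sum>j\<le>N. (norm (x j))\<^sup>2)"
proof -
  define M where "M = N + 2"
  have M: "M > 0" and Mi: "int M = int N + 2" by (simp_all add: M_def)
  define w where "w m d = cis (2 * pi * real m * of_int d / real M)" for m :: nat and d :: int
  have w_add: "w m (d + e) = w m d * w m e" for m d e
    by (simp add: w_def cis_mult algebra_simps add_divide_distrib)
  have w_cnj: "cnj (w m d) = w m (- d)" for m d
    by (simp add: w_def cis_cnj)
  have w_norm [simp]: "cmod (w m d) = 1" for m d by (simp add: w_def)
  have w_sum: "(\<Sum>m<M. w m d) = (if d = 0 then of_nat M else 0)" if "\<bar>d\<bar> < int M" for d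
    unfolding w_def by (rule sum_cis_roots_of_unity[OF M that])
  define F where "F m = (\<Sum>j\<le>N. w m (int j) *\<^sub>C x j)" for m
  have FE: "F m \<in> E" for m unfolding F_def by (intro csubspaceD[OF E] x)
  have TF: "T (F m) = (\<Sum>j\<le>N. w m (int j) *\<^sub>C T (x j))" for m
    unfolding F_def
    by (subst bounded_op_sum[OF T E]) (simp_all add: csubspaceD(3)[OF E] x bounded_opD(3)[OF T])
  have expand: "(\<Sum>m<M. w m c * cinner (\<Sum>j\<le>N. w m (int j) *\<^sub>C y j) (F m))
      = (\<Sum>j\<le>N. \<Sum>k\<le>N. cinner (y j) (x k) * (\<Sum>m<M. w m (c + int j - int k)))"
    for c and y :: "nat \<Rightarrow> 'e"
  proof -
    have "w m c * cinner (\<Sum>j\<le>N. w m (int j) *\<^sub>C y j) (F m)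
        = (\<Sum>j\<le>N. \<Sum>k\<le>N. cinner (y j) (x k) * w m (c + int j - int k))" for m
    proof -
      have "w m (c + int j - int k) = w m c * (w m (int j) * cnj (w m (int k)))" for j k
        unfolding w_cnj w_add[symmetric] by (simp add: algebra_simps)
      then show ?thesis
        unfolding F_def cinner_sum_left unfolding cinner_sum_right
        by (simp add: cinner_scaleC_left cinner_scaleC_right sum_distrib_left mult_ac)
    qed
    then have "(\<Sum>m<M. w m c * cinner (\<Sum>j\<le>N. w m (int j) *\<^sub>C y j) (F m))
        = (\<Sum>m<M. \<Sum>j\<le>N. \<Sum>k\<le>N. cinner (y j) (x k) * w m (c + int j - int k))" by simp
    also have "\<dots> = (\<Sum>j\<le>N. \<Sum>m<M. \<Sum>k\<le>N. cinner (y j) (x k) * w m (c + int j - int k))"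
      by (rule sum.swap)
    also have "\<dots> = (\<Sum>j\<le>N. \<Sum>k\<le>N. \<Sum>m<M. cinner (y j) (x k) * w m (c + int j - int k))"
      by (intro sum.cong refl sum.swap)
    finally show ?thesis by (simp add: sum_distrib_left)
  qed
  have "(\<Sum>m<M. w m 1 * cinner (T (F m)) (F m))
      = (\<Sum>j\<le>N. \<Sum>k\<le>N. cinner (T (x j)) (x k) * (\<Sum>m<M. w m (1 + int j - int k)))"
    unfolding TF by (rule expand)
  also have "\<dots> = (\<Sum>j\<le>N. \<Sum>k\<le>N. if k = Suc j then cinner (T (x j)) (x k) * of_nat M else 0)"
    by (intro sum.cong refl) (auto simp: w_sum Mi)
  also have "\<dots> = (\<Sum>j\<le>N. if j < N then cinner (T (x j)) (x (Suc j)) * of_nat M else 0)"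
    by (simp add: sum.delta Suc_le_eq)
  also have "\<dots> = (\<Sum>j<N. cinner (T (x j)) (x (Suc j)) * of_nat M)"
    by (simp add: lessThan_Suc_atMost[symmetric])
  finally have 1: "(\<Sum>m<M. w m 1 * cinner (T (F m)) (F m)) = of_nat M * (\<Sum>j<N. cinner (T (x j)) (x (Suc j)))"
    by (simp add: sum_distrib_left mult.commute)
  have "(\<Sum>m<M. w m 0 * cinner (F m) (F m))
      = (\<Sum>j\<le>N. \<Sum>k\<le>N. cinner (x j) (x k) * (\<Sum>m<M. w m (0 + int j - int k)))"
    using expand[of 0 x] by (simp only: F_def[symmetric])
  also have "\<dots> = (\<Sum>j\<le>N. \<Sum>k\<le>N. if k = j then cinner (x j) (x k) * of_nat M else 0)"
    by (intro sum.cong refl) (auto simp: w_sum Mi)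
  also have "\<dots> = of_nat M * (\<Sum>j\<le>N. cinner (x j) (x j))"
    by (simp add: sum.delta sum_distrib_left mult.commute)
  finally have "complex_of_real (\<Sum>m<M. (norm (F m))\<^sup>2) = complex_of_real (real M * (\<Sum>j\<le>N. (norm (x j))\<^sup>2))"
    by (simp add: cinner_self w_def)
  then have 2: "(\<Sum>m<M. (norm (F m))\<^sup>2) = real M * (\<Sum>j\<le>N. (norm (x j))\<^sup>2)"
    by (simp only: of_real_eq_iff)
  have "real M * cmod (\<Sum>j<N. cinner (T (x j)) (x (Suc j)))
      = cmod (\<Sum>m<M. w m 1 * cinner (T (F m)) (F m))"
    unfolding 1 by (simp add: norm_mult)
  also have "\<dots> \<le> (\<Sum>m<M. cmod (w m 1 * cinner (T (F m)) (F m)))" by (rule norm_sum)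
  also have "\<dots> \<le> (\<Sum>m<M. (norm (F m))\<^sup>2)"
    by (rule sum_mono) (simp add: norm_mult nr FE)
  finally show ?thesis using M by (simp add: 2)
qed

text \<open>
  The diagonal term \<open>A\<close> and the off-diagonal term \<open>A\<^sup>* z\<close> each contribute at most \<open>\<parallel>f\<parallel>\<^sup>2\<close>; the second
  one because \<open>A\<^sup>*\<close> has the numerical radius of \<open>A\<close>.
\<close>

lemma cmod_cinner_M_pencil_le:
  fixes E :: "'e::{complex_inner,complete_space} set"
  assumes E: "closed E" "csubspace E" and T: "bounded_op E E T"
    and nr: "numerical_radius E T \<le> 1" and f: "f \<in> H2 E"
  shows "cmod (cinner (M_pencil E T f) f) \<le> 2 * (norm f)\<^sup>2"
proof -
  note T' = bounded_op_adjoint_op[OF E T]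
  have nrT: "cmod (cinner (T h) h) \<le> (norm h)\<^sup>2" if "h \<in> E" for h
    using nr that numerical_radius_le_1_iff[OF E(2) T] by blast
  have nrT': "cmod (cinner (adjoint_op E T h) h) \<le> (norm h)\<^sup>2" if "h \<in> E" for h
    using nrT[OF that] adjoint_op_left[OF E T that, of h] cinner_commute[of h "T h"] by simp
  have le1: "cmod (\<Sum>n<N. cinner (h2_coeff (h2_map T f) n) (h2_coeff f n)) \<le> (norm f)\<^sup>2" for N
  proof -
    have "cmod (\<Sum>n<N. cinner (h2_coeff (h2_map T f) n) (h2_coeff f n))
        \<le> (\<Sum>n<N. (norm (h2_coeff f n))\<^sup>2)"
      by (rule order_trans[OF norm_sum sum_mono]) (simp add: h2_map(1)[OF T f] nrT H2_coeff[OF f])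
    then show ?thesis using h2_partial_sum_le[of f N] by linarith
  qed
  have le2: "cmod (\<Sum>n<N. cinner (h2_coeff (shift (h2_map (adjoint_op E T) f)) n) (h2_coeff f n))
      \<le> (norm f)\<^sup>2" for N
  proof (cases N)
    case (Suc K)
    have "(\<Sum>n<N. cinner (h2_coeff (shift (h2_map (adjoint_op E T) f)) n) (h2_coeff f n))
        = (\<Sum>n<K. cinner (adjoint_op E T (h2_coeff f n)) (h2_coeff f (Suc n)))"
      unfolding Suc sum.lessThan_Suc_shift by (simp add: h2_map(1)[OF T' f])
    then show ?thesis
      using sum_consecutive_cinner_le[OF E(2) T' nrT', of "h2_coeff f" K] H2_coeff[OF f]
        h2_partial_sum_le[of f "Suc K"] by (simp add: lessThan_Suc_atMost)
  qed simp
  have lim: "cmod s \<le> (norm f)\<^sup>2" if "a sums s" "\<And>N. cmod (\<Sum>n<N. a n) \<le> (norm f)\<^sup>2" for a s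
    using that unfolding sums_def by (intro LIMSEQ_le_const2[OF tendsto_norm]) auto
  have "cmod (cinner (h2_map T f) f) \<le> (norm f)\<^sup>2"
    "cmod (cinner (shift (h2_map (adjoint_op E T) f)) f) \<le> (norm f)\<^sup>2"
    using lim[OF h2_cinner_sums le1] lim[OF h2_cinner_sums le2] by auto
  then show ?thesis
    using norm_triangle_ineq[of "cinner (h2_map T f) f" "cinner (shift (h2_map (adjoint_op E T) f)) f"]
    by (simp add: M_pencil_eq[OF E T f] cinner_add_left)
qed

text \<open>
  Conversely, the form is tested on the truncated geometric series \<open>\<Sum> c\<^sup>n z\<^sup>n h\<close> with a unimodular
  \<open>c\<close> chosen so that both terms of the pencil contribute \<open>\<langle>T h, h\<rangle>\<close> with the same argument.  The
  length \<open>N\<close> costs only one missing term out of \<open>2 N\<close>.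
\<close>

lemma numerical_radius_le_1_if_M_pencil_bounded:
  fixes E :: "'e::{complex_inner,complete_space} set"
  assumes E: "closed E" "csubspace E" and T: "bounded_op E E T"
    and le: "\<And>f. f \<in> H2 E \<Longrightarrow> cmod (cinner (M_pencil E T f) f) \<le> 2 * (norm f)\<^sup>2"
  shows "numerical_radius E T \<le> 1"
  unfolding numerical_radius_le_1_iff[OF E(2) T]
proof
  fix h assume h: "h \<in> E"
  note T' = bounded_op_adjoint_op[OF E T]
  define b where "b = cinner (T h) h"
  have b': "cinner (adjoint_op E T h) h = cnj b"
    using adjoint_op_left[OF E T h, of h] cinner_commute[of h "T h"] by (simp add: b_def)
  have main: "(2 * real N + 1) * cmod b \<le> 2 * (real N + 1) * (norm h)\<^sup>2" for N
  proof (cases "b = 0")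
    case False
    (* cnj c * cnj b = b makes both terms of the pencil contribute b itself *)
    define c where "c = cnj b / b"
    have c: "cmod c = 1" "cnj c * cnj b = b" using False by (simp_all add: c_def norm_divide)
    have cc: "c ^ n * cnj c ^ n = 1" for n
      using c(1) complex_norm_square[of c] by (simp add: power_mult_distrib[symmetric])
    define a where "a n = (if n \<le> N then c ^ n *\<^sub>C h else 0)" for n
    define f where "f = Abs_h2 a"
    have "summable (\<lambda>n. (norm (a n))\<^sup>2)"
      by (rule summable_finite[of "{..N}"]) (auto simp: a_def)
    then have co: "h2_coeff f n = a n" for n unfolding f_def by (rule h2_coeff_Abs_h2)
    have f: "f \<in> H2 E" using h csubspaceD[OF E(2)] by (simp add: H2_def co a_def)
    have "(\<lambda>n. (norm (a n))\<^sup>2) sums (\<Sum>n\<le>N. (norm (a n))\<^sup>2)"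
      by (rule sums_finite) (auto simp: a_def)
    moreover have "(\<Sum>n\<le>N. (norm (a n))\<^sup>2) = (\<Sum>n\<le>N. (norm h)\<^sup>2)"
      by (rule sum.cong) (auto simp: a_def norm_scaleC norm_power c)
    ultimately have nf: "(norm f)\<^sup>2 = (real N + 1) * (norm h)\<^sup>2"
      using h2_norm_sums[of f] by (simp add: co sums_unique2 add.commute)
    have "cinner (M_pencil E T f) f = (\<Sum>n\<le>N. cinner (h2_coeff (M_pencil E T f) n) (a n))"
      using h2_cinner_sums[of "M_pencil E T f" f]
        sums_finite[of "{..N}" "\<lambda>n. cinner (h2_coeff (M_pencil E T f) n) (a n)"]
      by (simp add: co sums_unique2 a_def)
    also have "\<dots> = cinner (T h) h + (\<Sum>n<N. cinner (h2_coeff (M_pencil E T f) (Suc n)) (a (Suc n)))"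
      unfolding lessThan_Suc_atMost[symmetric] sum.lessThan_Suc_shift
      by (simp add: h2_coeff_M_pencil[OF E T f] co a_def scaleC_one)
    also have "(\<Sum>n<N. cinner (h2_coeff (M_pencil E T f) (Suc n)) (a (Suc n))) = (\<Sum>n<N. 2 * b)"
    proof (rule sum.cong)
      fix n assume "n \<in> {..<N}"
      then have "cinner (h2_coeff (M_pencil E T f) (Suc n)) (a (Suc n))
          = (c ^ Suc n * cnj c ^ Suc n) * b + (c ^ n * cnj c ^ n) * (cnj c * cnj b)"
        by (simp add: h2_coeff_M_pencil[OF E T f] co a_def bounded_opD(3)[OF T h]
            bounded_opD(3)[OF T' h] cinner_add_left cinner_scaleC_left cinner_scaleC_right b'
            b_def[symmetric] algebra_simps)
      then show "cinner (h2_coeff (M_pencil E T f) (Suc n)) (a (Suc n)) = 2 * b"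
        by (simp only: cc c mult_1 mult_2)
    qed simp
    finally have "cinner (M_pencil E T f) f = of_real (2 * real N + 1) * b"
      by (simp add: b_def algebra_simps)
    then have "cmod (cinner (M_pencil E T f) f) = \<bar>2 * real N + 1\<bar> * cmod b"
      by (simp only: norm_mult norm_of_real)
    moreover have "\<bar>2 * real N + 1\<bar> = 2 * real N + 1" by simp
    ultimately show ?thesis using le[OF f] unfolding nf by (simp only: mult.assoc)
  qed simp
  show "cmod (cinner (T h) h) \<le> (norm h)\<^sup>2"
  proof (rule ccontr)
    assume "\<not> ?thesis"
    then have pos: "cmod b - (norm h)\<^sup>2 > 0" by (simp add: b_def)
    then obtain N :: nat where "cmod b < real N * (cmod b - (norm h)\<^sup>2)"
      using reals_Archimedean3[OF pos] by blast
    then show False using main[of N] pos zero_le_power2[of "norm h"] by (simp add: algebra_simps)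
  qed
qed

section \<open>Operators with the symmetry of a pencil\<close>

text \<open>
  By symmetry, the inner products of \<open>X h\<close> for a constant \<open>h\<close> with \<open>z\<^sup>n\<^sup>+\<^sup>1 k\<close> equal those of \<open>h\<close> with
  \<open>z\<^sup>n X k\<close>.  They vanish for \<open>n > 0\<close>, so \<open>X h\<close> has degree at most one, and for \<open>n = 0\<close> they say that
  its two coefficients are given by mutually adjoint operators.  Applied to an arbitrary first
  argument, the same identity then yields every coefficient but the zeroth.
\<close>

lemma pencil_if_symmetric:
  fixes E :: "'e::{complex_inner,complete_space} set"
  assumes E: "closed E" "csubspace E" and X: "bounded_op (H2 E) (H2 E) X"
    and shift: "\<And>f. f \<in> H2 E \<Longrightarrow> X (shift f) = shift (X f)"
    and sym: "\<And>f g. f \<in> H2 E \<Longrightarrow> g \<in> H2 E \<Longrightarrow> cinner (X f) (shift g) = cinner f (X g)"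
  shows "\<exists>B. bounded_op E E B \<and> (\<forall>f\<in>H2 E. X f = M_pencil E B f)"
proof -
  define B where "B h = h2_coeff (X (h2_const h)) 0" for h
  define C where "C h = h2_coeff (X (h2_const h)) 1" for h
  note const = h2_const_in_H2[OF E(2)]
  note inH = H2_coeff[OF bounded_opD(1)[OF X]]
  obtain K where K: "\<And>f. f \<in> H2 E \<Longrightarrow> norm (X f) \<le> K * norm f"
    using bounded_op_bound[OF X] by blast
  have normB: "norm (B h) \<le> K * norm h" if "h \<in> E" for h
  proof -
    have "norm (B h) \<le> norm (X (h2_const h))" unfolding B_def by (rule norm_h2_coeff_le)
    also have "\<dots> \<le> K * norm h" using K[OF const[OF that]] by simp
    finally show ?thesis .
  qed
  have B: "bounded_op E E B"
    unfolding bounded_op_def using normB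
    by (auto simp: B_def inH const h2_const_add h2_const_scaleC bounded_opD[OF X])
  have shift_pow: "(shift ^^ n) f \<in> H2 E" "X ((shift ^^ n) f) = (shift ^^ n) (X f)"
    if "f \<in> H2 E" for n f
    using that by (induction n) (simp_all add: shift_in_H2[OF E(2)] shift)
  have coeff_Suc: "cinner (h2_coeff (X f) (Suc n)) k = cinner f ((shift ^^ n) (X (h2_const k)))"
    if "f \<in> H2 E" "k \<in> E" for f n k
  proof -
    have "cinner (h2_coeff (X f) (Suc n)) k = cinner (X f) (shift ((shift ^^ n) (h2_const k)))"
      using cinner_shift_power_const[of "X f" "Suc n" k] by simp
    also have "\<dots> = cinner f ((shift ^^ n) (X (h2_const k)))"
      by (simp add: sym that shift_pow const)
    finally show ?thesis .
  qed
  have cinner_const: "cinner (h2_const h) g = cinner h (h2_coeff g 0)" for h g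
    using cinner_shift_power_const[of g 0 h] by (metis cinner_commute funpow_0)
  have "h2_coeff (X (h2_const h)) (Suc (Suc n)) = 0" if h: "h \<in> E" for h n
  proof (rule cinner_eq_on_subspace[OF E(2)])
    show "cinner (h2_coeff (X (h2_const h)) (Suc (Suc n))) k = cinner 0 k" if "k \<in> E" for k
      by (simp add: coeff_Suc h that const cinner_const h2_coeff_shift_power del: funpow.simps)
  qed (simp_all add: inH const h csubspaceD(1)[OF E(2)])
  then have Xconst: "X (h2_const h) = h2_const (B h) + shift (h2_const (C h))" if "h \<in> E" for h
  proof -
    have "h2_coeff (X (h2_const h)) n = h2_coeff (h2_const (B h) + shift (h2_const (C h))) n" for n
    proof (cases n)
      case (Suc m)
      then show ?thesis
        using \<open>\<And>h n. h \<in> E \<Longrightarrow> h2_coeff (X (h2_const h)) (Suc (Suc n)) = 0\<close>[OF that]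
        by (cases m) (simp_all add: C_def)
    qed (simp add: B_def)
    then show ?thesis by (rule h2_eqI)
  qed
  have C: "cinner (C h) k = cinner h (B k)" if "h \<in> E" "k \<in> E" for h k
    using coeff_Suc[OF const[OF that(1)] that(2), of 0] by (simp add: C_def B_def cinner_const)
  have CE: "C h \<in> E" if "h \<in> E" for h using that by (simp add: C_def inH const)
  have adj: "adjoint_op E B h = C h" if "h \<in> E" for h
    by (rule adjoint_op_unique[OF E B]) (simp_all add: that CE C)
  have "X f = M_pencil E B f" if f: "f \<in> H2 E" for f
  proof (rule h2_eqI_Suc)
    obtain g where g: "f = h2_const (h2_coeff f 0) + shift g" "\<And>n. h2_coeff g n = h2_coeff f (Suc n)"
      using h2_eq_const_plus_shift by blast
    then have gE: "g \<in> H2 E" using f by (simp add: H2_def)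
    have "X f = X (h2_const (h2_coeff f 0)) + shift (X g)"
      using bounded_opD(2)[OF X const[OF H2_coeff[OF f, of 0]] shift_in_H2[OF E(2) gE]] g(1)
      by (simp add: shift gE)
    then show "h2_coeff (X f) 0 = h2_coeff (M_pencil E B f) 0"
      by (simp add: h2_coeff_M_pencil[OF E B f] B_def)
  next
    fix n
    show "h2_coeff (X f) (Suc n) = h2_coeff (M_pencil E B f) (Suc n)"
    proof (rule cinner_eq_on_subspace[OF E(2)])
      fix k assume k: "k \<in> E"
      have "(shift ^^ n) (X (h2_const k)) = (shift ^^ n) (h2_const (B k)) + (shift ^^ Suc n) (h2_const (C k))"
        by (simp add: Xconst k shift_power_add funpow_swap1)
      then have "cinner (h2_coeff (X f) (Suc n)) k
          = cinner (h2_coeff f n) (B k) + cinner (h2_coeff f (Suc n)) (C k)"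
        by (simp only: coeff_Suc[OF f k] cinner_add_right cinner_shift_power_const)
      also have "cinner (h2_coeff f (Suc n)) (C k) = cinner (B (h2_coeff f (Suc n))) k"
        using C[OF k H2_coeff[OF f, of "Suc n"]] by (metis cinner_commute)
      finally show "cinner (h2_coeff (X f) (Suc n)) k = cinner (h2_coeff (M_pencil E B f) (Suc n)) k"
        by (simp add: h2_coeff_M_pencil[OF E B f] cinner_add_left adj H2_coeff[OF f] C k)
    qed (simp_all add: f inH H2_coeff[OF M_pencil_in_H2[OF E B f]])
  qed
  then show ?thesis using B by blast
qed

section \<open>Multiplication by an inner function\<close>

lemma H2_UNIV [simp]: "H2 UNIV = UNIV"
  by (simp add: H2_def)

lemma csubspace_UNIV: "csubspace UNIV"
  by (simp add: complex_vector.subspace_def)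

context
  fixes E :: "'e::{complex_inner,complete_space} set"
    and \<Theta> :: "complex \<Rightarrow> 'e \<Rightarrow> 'f::{complex_inner,complete_space}"
  assumes E: "closed E" "csubspace E" and \<Theta>: "inner_function E UNIV \<Theta>"
begin

lemma bounded_op_inner_function: "cmod z < 1 \<Longrightarrow> bounded_op E UNIV (\<Theta> z)"
  using \<Theta> by (simp add: inner_function_def H_infty_def)

lemma norm_mult_op: "f \<in> H2 E \<Longrightarrow> norm (mult_op \<Theta> f) = norm f"
  using \<Theta> by (simp add: inner_function_def)

text \<open>
  The product of an inner function with any \<open>f\<close> is in the Hardy space.  Were it not, then the
  product with \<open>2 f\<close> would not be either, and \<^term>\<open>mult_op\<close> would take the same arbitrary value at \<open>f\<close>
  and \<open>2 f\<close>, although it preserves their different norms.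
\<close>

lemma h2_eval_mult_op:
  assumes f: "f \<in> H2 E" and z: "cmod z < 1"
  shows "h2_eval (mult_op \<Theta> f) z = \<Theta> z (h2_eval f z)"
proof -
  have "\<exists>g. \<forall>z\<in>ball 0 1. h2_eval g z = \<Theta> z (h2_eval f z)"
  proof (rule ccontr)
    assume no: "\<not> ?thesis"
    define f2 where "f2 = 2 *\<^sub>C f"
    have f2: "f2 \<in> H2 E" using csubspaceD(3)[OF csubspace_H2[OF E(2)] f] by (simp add: f2_def)
    have eq: "\<Theta> z (h2_eval f2 z) = 2 *\<^sub>C \<Theta> z (h2_eval f z)" if "cmod z < 1" for z
      by (simp add: f2_def h2_eval_scaleC that bounded_opD(3)[OF bounded_op_inner_function]
          h2_eval_in[OF E f])
    have no2: "\<not> (\<forall>z\<in>ball 0 1. h2_eval g z = \<Theta> z (h2_eval f2 z))" for g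
    proof
      assume "\<forall>z\<in>ball 0 1. h2_eval g z = \<Theta> z (h2_eval f2 z)"
      then have "\<forall>z\<in>ball 0 1. h2_eval ((1/2) *\<^sub>C g) z = \<Theta> z (h2_eval f z)"
        by (simp add: h2_eval_scaleC eq scaleC_scaleC scaleC_one)
      then show False using no by blast
    qed
    have "mult_op \<Theta> f = mult_op \<Theta> f2"
      unfolding mult_op_def using no no2 by (intro arg_cong[where f = The] ext) blast
    then have "norm f = norm f2" using norm_mult_op[OF f] norm_mult_op[OF f2] by simp
    then have "f = 0" by (simp add: f2_def norm_scaleC)
    then have "\<forall>z\<in>ball 0 1. h2_eval 0 z = \<Theta> z (h2_eval f z)"
      by (simp add: h2_eval_def bounded_op_zero[OF bounded_op_inner_function E(2)])
    then show False using no by blast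
  qed
  then obtain g where g: "\<forall>z\<in>ball 0 1. h2_eval g z = \<Theta> z (h2_eval f z)" by blast
  then have "mult_op \<Theta> f = g" by (intro mult_op_eqI) simp
  then show ?thesis using g z by simp
qed

lemma mult_op_add:
  "f \<in> H2 E \<Longrightarrow> g \<in> H2 E \<Longrightarrow> mult_op \<Theta> (f + g) = mult_op \<Theta> f + mult_op \<Theta> g"
  by (rule mult_op_eqI)
    (simp add: h2_eval_add h2_eval_mult_op bounded_opD(2)[OF bounded_op_inner_function] h2_eval_in[OF E])

lemma mult_op_scaleC:
  "f \<in> H2 E \<Longrightarrow> mult_op \<Theta> (a *\<^sub>C f) = a *\<^sub>C mult_op \<Theta> f"
  by (rule mult_op_eqI)
    (simp add: h2_eval_scaleC h2_eval_mult_op bounded_opD(3)[OF bounded_op_inner_function] h2_eval_in[OF E])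

lemma mult_op_shift:
  "f \<in> H2 E \<Longrightarrow> mult_op \<Theta> (shift f) = shift (mult_op \<Theta> f)"
  by (rule mult_op_eqI)
    (simp add: h2_eval_shift h2_eval_mult_op bounded_opD(3)[OF bounded_op_inner_function] h2_eval_in[OF E])

lemma cinner_mult_op:
  "f \<in> H2 E \<Longrightarrow> g \<in> H2 E \<Longrightarrow> cinner (mult_op \<Theta> f) (mult_op \<Theta> g) = cinner f g"
  by (rule isometry_cinner[OF csubspace_H2[OF E(2)]]) (simp_all add: mult_op_add mult_op_scaleC norm_mult_op)

lemma bounded_op_mult_op: "bounded_op (H2 E) UNIV (mult_op \<Theta>)"
  unfolding bounded_op_def by (auto simp: mult_op_add mult_op_scaleC norm_mult_op intro!: exI[of _ 1])

lemma inj_on_mult_op: "inj_on (mult_op \<Theta>) (H2 E)"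
proof (rule inj_onI)
  fix f g assume fg: "f \<in> H2 E" "g \<in> H2 E" "mult_op \<Theta> f = mult_op \<Theta> g"
  then have "norm (f - g) = 0"
    using norm_mult_op[OF csubspaceD(4)[OF csubspace_H2[OF E(2)] fg(1,2)]]
      bounded_op_diff[OF bounded_op_mult_op csubspace_H2[OF E(2)] fg(1,2)] by simp
  then show "f = g" by simp
qed

lemma mult_op_const_inj:
  assumes "h \<in> E" "k \<in> E" "mult_op \<Theta> (h2_const h) = mult_op \<Theta> (h2_const k)"
  shows "h = k"
proof -
  have "h2_const h = h2_const k"
    using inj_onD[OF inj_on_mult_op assms(3)] h2_const_in_H2[OF E(2)] assms by blast
  then show ?thesis by (metis h2_coeff_simps(6))
qed

end

section \<open>Invariance and intertwining for a given representation\<close>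

lemma BLH_representationD:
  assumes "BLH_representation S E \<Theta>"
  shows "closed E" "csubspace E" "inner_function E UNIV \<Theta>" "S = mult_op \<Theta> ` H2 E"
  using assms by (simp_all add: BLH_representation_def)

lemma invariant_if_intertwines:
  fixes A :: "'h \<Rightarrow> 'h::{complex_inner,complete_space}"
    and E :: "'e::{complex_inner,complete_space} set"
  assumes R: "BLH_representation S E \<Theta>" and B: "intertwines A E \<Theta> B"
  shows "M_pencil UNIV A ` S \<subseteq> S" "M_z ` S \<subseteq> S"
proof -
  note R = BLH_representationD[OF R]
  have B: "bounded_op E E B"
    "\<And>f. f \<in> H2 E \<Longrightarrow> M_pencil UNIV A (mult_op \<Theta> f) = mult_op \<Theta> (M_pencil E B f)"
    using B by (simp_all add: intertwines_def)
  show "M_pencil UNIV A ` S \<subseteq> S"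
    unfolding R(4) using B(2) M_pencil_in_H2[OF R(1,2) B(1)] by auto
  show "M_z ` S \<subseteq> S"
    unfolding R(4) M_z_eq_shift using mult_op_shift[OF R(1-3), symmetric] shift_in_H2[OF R(2)] by auto
qed

text \<open>
  Let \<open>V\<close> be multiplication by \<open>\<Theta>\<close>.  On an invariant \<open>S\<close> the pencil of \<open>A\<close> is \<open>V X V\<^sup>*\<close> for an operator
  \<open>X\<close> that inherits its symmetry and the bound of its quadratic form, hence is the pencil of an
  operator with numerical radius at most one.
\<close>

lemma intertwines_if_invariant:
  fixes A :: "'h \<Rightarrow> 'h::{complex_inner,complete_space}"
    and E :: "'e::{complex_inner,complete_space} set"
  assumes A: "bounded_op UNIV UNIV A" "numerical_radius UNIV A \<le> 1"
    and R: "BLH_representation S E \<Theta>" and inv: "M_pencil UNIV A ` S \<subseteq> S"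
  shows "\<exists>B. intertwines A E \<Theta> B"
proof -
  note R = BLH_representationD[OF R]
  note V = bounded_op_mult_op[OF R(1-3)]
  note Hsub = csubspace_H2[OF R(2)]
  note PA = bounded_op_M_pencil[OF closed_UNIV csubspace_UNIV A(1), unfolded H2_UNIV]
  define X where "X f = inv_into (H2 E) (mult_op \<Theta>) (M_pencil UNIV A (mult_op \<Theta> f))" for f
  have X: "X f \<in> H2 E" "mult_op \<Theta> (X f) = M_pencil UNIV A (mult_op \<Theta> f)" if "f \<in> H2 E" for f
  proof -
    have "M_pencil UNIV A (mult_op \<Theta> f) \<in> mult_op \<Theta> ` H2 E"
      using inv imageI[OF that, of "mult_op \<Theta>"] unfolding R(4) by auto
    then show "X f \<in> H2 E" "mult_op \<Theta> (X f) = M_pencil UNIV A (mult_op \<Theta> f)"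
      unfolding X_def by (fact inv_into_into f_inv_into_f)+
  qed
  have X_eqI: "X f = g" if "f \<in> H2 E" "g \<in> H2 E" "mult_op \<Theta> g = M_pencil UNIV A (mult_op \<Theta> f)" for f g
    using inj_onD[OF inj_on_mult_op[OF R(1-3)], of "X f" g] X[OF that(1)] that by simp
  obtain K where K: "\<And>f. f \<in> UNIV \<Longrightarrow> norm (M_pencil UNIV A f) \<le> K * norm f"
    using bounded_op_bound[OF PA] by blast
  have "norm (X f) \<le> K * norm f" if "f \<in> H2 E" for f
    using K[OF UNIV_I, of "mult_op \<Theta> f"] norm_mult_op[OF R(1-3) that] norm_mult_op[OF R(1-3) X(1)[OF that]]
    by (simp add: X(2)[OF that])
  moreover have "X (f + g) = X f + X g" if "f \<in> H2 E" "g \<in> H2 E" for f g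
    by (rule X_eqI)
      (simp_all add: that X csubspaceD[OF Hsub] bounded_opD(2)[OF V] bounded_opD(2)[OF PA])
  moreover have "X (a *\<^sub>C f) = a *\<^sub>C X f" if "f \<in> H2 E" for a f
    by (rule X_eqI)
      (simp_all add: that X csubspaceD[OF Hsub] bounded_opD(3)[OF V] bounded_opD(3)[OF PA])
  ultimately have Xb: "bounded_op (H2 E) (H2 E) X" unfolding bounded_op_def using X(1) by blast
  have Xshift: "X (shift f) = shift (X f)" if "f \<in> H2 E" for f
    by (rule X_eqI)
      (simp_all add: that X shift_in_H2[OF R(2)] mult_op_shift[OF R(1-3)]
        M_pencil_shift[OF closed_UNIV csubspace_UNIV A(1)])
  have Xsym: "cinner (X f) (shift g) = cinner f (X g)" if fg: "f \<in> H2 E" "g \<in> H2 E" for f g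
  proof -
    have "cinner (X f) (shift g) = cinner (M_pencil UNIV A (mult_op \<Theta> f)) (shift (mult_op \<Theta> g))"
      using cinner_mult_op[OF R(1-3) X(1)[OF fg(1)] shift_in_H2[OF R(2) fg(2)]]
      by (simp add: X(2) fg mult_op_shift[OF R(1-3)])
    also have "\<dots> = cinner (mult_op \<Theta> f) (M_pencil UNIV A (mult_op \<Theta> g))"
      by (rule M_pencil_symmetric[OF closed_UNIV csubspace_UNIV A(1)]) simp_all
    also have "\<dots> = cinner f (X g)"
      using cinner_mult_op[OF R(1-3) fg(1) X(1)[OF fg(2)]] by (simp add: X(2) fg)
    finally show ?thesis .
  qed
  obtain B where B: "bounded_op E E B" "\<And>f. f \<in> H2 E \<Longrightarrow> X f = M_pencil E B f"
    using pencil_if_symmetric[OF R(1,2) Xb Xshift Xsym] by blast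
  have "cmod (cinner (M_pencil E B f) f) \<le> 2 * (norm f)\<^sup>2" if f: "f \<in> H2 E" for f
  proof -
    have "cinner (M_pencil E B f) f = cinner (M_pencil UNIV A (mult_op \<Theta> f)) (mult_op \<Theta> f)"
      using cinner_mult_op[OF R(1-3) X(1)[OF f] f] by (simp add: X(2)[OF f, symmetric] B(2)[OF f, symmetric])
    then show ?thesis
      using cmod_cinner_M_pencil_le[OF closed_UNIV csubspace_UNIV A, of "mult_op \<Theta> f"]
      by (simp add: norm_mult_op[OF R(1-3) f])
  qed
  then have "numerical_radius E B \<le> 1"
    by (rule numerical_radius_le_1_if_M_pencil_bounded[OF R(1,2) B(1)])
  then have "intertwines A E \<Theta> B" unfolding intertwines_def using B X(2) by metis
  then show ?thesis by blast
qed

section \<open>Uniqueness of the representation and of the intertwined operator\<close>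

text \<open>
  The constants are the orthogonal complement of the range of the shift.  The map from \<^term>\<open>H2 E\<close>
  to \<^term>\<open>H2 E'\<close> that takes \<open>f\<close> to the \<open>g\<close> with \<open>\<Theta> f = \<Theta>' g\<close> is unitary and commutes with the shift,
  so it sends constants to constants.
\<close>

lemma mult_op_const_eq_mult_op_const:
  fixes E :: "'e::{complex_inner,complete_space} set" and E' :: "'e'::{complex_inner,complete_space} set"
    and S :: "'h::{complex_inner,complete_space} h2 set"
  assumes R: "BLH_representation S E \<Theta>" and R': "BLH_representation S E' \<Theta>'" and h: "h \<in> E"
  shows "\<exists>k\<in>E'. mult_op \<Theta> (h2_const h) = mult_op \<Theta>' (h2_const k)"
proof -
  note R = BLH_representationD[OF R] and R' = BLH_representationD[OF R']
  note ch = h2_const_in_H2[OF R(2) h]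
  have "mult_op \<Theta> (h2_const h) \<in> mult_op \<Theta>' ` H2 E'" using ch R(4) R'(4) by blast
  then obtain f where f: "f \<in> H2 E'" "mult_op \<Theta> (h2_const h) = mult_op \<Theta>' f" by blast
  have "h2_coeff f (Suc n) = 0" for n
  proof (rule cinner_eq_on_subspace[OF R'(2)])
    fix k assume k: "k \<in> E'"
    define g where "g = (shift ^^ n) (h2_const k)"
    have g: "g \<in> H2 E'"
      unfolding g_def by (induction n) (simp_all add: h2_const_in_H2 k R'(2) shift_in_H2)
    then have "mult_op \<Theta>' g \<in> mult_op \<Theta> ` H2 E" using R(4) R'(4) by blast
    then obtain g' where g': "g' \<in> H2 E" "mult_op \<Theta>' g = mult_op \<Theta> g'" by blast
    have "cinner (h2_coeff f (Suc n)) k = cinner f (shift g)"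
      using cinner_shift_power_const[of f "Suc n" k] by (simp add: g_def)
    also have "\<dots> = cinner (mult_op \<Theta>' f) (shift (mult_op \<Theta>' g))"
      using cinner_mult_op[OF R'(1-3) f(1) shift_in_H2[OF R'(2) g]]
      by (simp add: mult_op_shift[OF R'(1-3) g])
    also have "\<dots> = cinner (h2_const h) (shift g')"
      using cinner_mult_op[OF R(1-3) ch shift_in_H2[OF R(2) g'(1)]]
      by (simp add: mult_op_shift[OF R(1-3) g'(1)] f(2) g'(2))
    also have "\<dots> = 0" by (rule cinner_eq_zero_commute) (rule cinner_shift_const)
    finally show "cinner (h2_coeff f (Suc n)) k = cinner 0 k" by simp
  qed (simp_all add: H2_coeff[OF f(1)] csubspaceD(1)[OF R'(2)])
  then have "f = h2_const (h2_coeff f 0)" by (intro h2_eqI_Suc) simp_all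
  then show ?thesis using f H2_coeff[OF f(1), of 0] by metis
qed

text \<open>
  The unitary \<open>U\<close> is the correspondence of constants.  Applying the pencil of \<open>A\<close> to
  \<open>\<Theta> h = \<Theta>' (U h)\<close> and cancelling \<open>\<Theta>'\<close> gives two elements of degree at most one, and their zeroth coefficients
  are \<open>U (B h)\<close> and \<open>B' (U h)\<close>.
\<close>

lemma intertwined_operator_unique:
  fixes A :: "'h \<Rightarrow> 'h::{complex_inner,complete_space}"
    and E :: "'e::{complex_inner,complete_space} set" and E' :: "'e'::{complex_inner,complete_space} set"
  assumes BLH: "BLH_representation S E \<Theta>" "BLH_representation S E' \<Theta>'"
    and B: "intertwines A E \<Theta> B" and B': "intertwines A E' \<Theta>' B'"
  shows "\<exists>U. unitary_op E E' U \<and> (\<forall>z\<in>ball 0 1. \<forall>h\<in>E. \<Theta> z h = \<Theta>' z (U h)) \<and> (\<forall>h\<in>E. U (B h) = B' (U h))"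
proof -
  note R = BLH_representationD[OF BLH(1)] and R' = BLH_representationD[OF BLH(2)]
  note sub = csubspaceD[OF R(2)] and sub' = csubspaceD[OF R'(2)]
  note const = h2_const_in_H2[OF R(2)] and const' = h2_const_in_H2[OF R'(2)]
  have B: "bounded_op E E B"
    "\<And>f. f \<in> H2 E \<Longrightarrow> M_pencil UNIV A (mult_op \<Theta> f) = mult_op \<Theta> (M_pencil E B f)"
    using B by (simp_all add: intertwines_def)
  have B': "bounded_op E' E' B'"
    "\<And>f. f \<in> H2 E' \<Longrightarrow> M_pencil UNIV A (mult_op \<Theta>' f) = mult_op \<Theta>' (M_pencil E' B' f)"
    using B' by (simp_all add: intertwines_def)
  have "\<forall>h\<in>E. \<exists>k\<in>E'. mult_op \<Theta> (h2_const h) = mult_op \<Theta>' (h2_const k)"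
    using mult_op_const_eq_mult_op_const[OF BLH] by blast
  then obtain U where UE: "\<And>h. h \<in> E \<Longrightarrow> U h \<in> E'"
    and U: "\<And>h. h \<in> E \<Longrightarrow> mult_op \<Theta> (h2_const h) = mult_op \<Theta>' (h2_const (U h))"
    by metis
  have U_eqI: "U h = k" if "h \<in> E" "k \<in> E'" "mult_op \<Theta> (h2_const h) = mult_op \<Theta>' (h2_const k)" for h k
    using mult_op_const_inj[OF R'(1-3) UE[OF that(1)] that(2)] U[OF that(1)] that(3) by simp
  have Uadd: "U (x + y) = U x + U y" if "x \<in> E" "y \<in> E" for x y
    by (rule U_eqI)
      (simp_all add: that sub sub' UE U h2_const_add mult_op_add[OF R(1-3)] mult_op_add[OF R'(1-3)] const const')
  have Uscale: "U (a *\<^sub>C x) = a *\<^sub>C U x" if "x \<in> E" for a x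
    by (rule U_eqI)
      (simp_all add: that sub sub' UE U h2_const_scaleC mult_op_scaleC[OF R(1-3)] mult_op_scaleC[OF R'(1-3)] const const')
  have Unorm: "norm (U x) = norm x" if "x \<in> E" for x
    using norm_mult_op[OF R(1-3) const[OF that]] norm_mult_op[OF R'(1-3) const'[OF UE[OF that]]]
    by (simp add: U that)
  have "U ` E = E'"
  proof (intro equalityI subsetI)
    fix k assume k: "k \<in> E'"
    then obtain h where "h \<in> E" "mult_op \<Theta>' (h2_const k) = mult_op \<Theta> (h2_const h)"
      using mult_op_const_eq_mult_op_const[OF BLH(2,1)] by blast
    then show "k \<in> U ` E" using U_eqI[of h k] k by force
  qed (use UE in auto)
  moreover have "bounded_op E E' U"
    unfolding bounded_op_def using UE Uadd Uscale Unorm by (auto intro!: exI[of _ 1])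
  ultimately have "unitary_op E E' U"
    unfolding unitary_op_def using isometry_cinner[OF R(2) _ _ Uadd Uscale Unorm] by blast
  moreover have ev: "\<Theta> z h = \<Theta>' z (U h)" if "cmod z < 1" "h \<in> E" for z h
    using h2_eval_mult_op[OF R(1-3) const[OF that(2)] that(1)]
      h2_eval_mult_op[OF R'(1-3) const'[OF UE[OF that(2)]] that(1)]
    by (simp add: U that)
  moreover have "U (B h) = B' (U h)" if h: "h \<in> E" for h
  proof -
    define D where "D = adjoint_op E B h"
    have BD: "B h \<in> E" "D \<in> E" using bounded_opD(1)[OF B(1) h] adjoint_op(1)[OF R(1,2) B(1)] by (auto simp: D_def)
    have pencil: "M_pencil E B (h2_const h) = h2_const (B h) + shift (h2_const D)"
      by (rule h2_eqI_Suc, simp_all add: h2_coeff_M_pencil[OF R(1,2) B(1)] const h D_def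
          bounded_op_zero[OF B(1) R(2)] bounded_op_zero[OF bounded_op_adjoint_op[OF R(1,2) B(1)] R(2)])
    have "mult_op \<Theta> (h2_const (B h) + shift (h2_const D))
        = mult_op \<Theta>' (h2_const (U (B h)) + shift (h2_const (U D)))"
      by (simp add: mult_op_add[OF R(1-3)] mult_op_add[OF R'(1-3)] mult_op_shift[OF R(1-3)]
          mult_op_shift[OF R'(1-3)] U UE const const' BD shift_in_H2[OF R(2)] shift_in_H2[OF R'(2)])
    moreover have "mult_op \<Theta> (h2_const (B h) + shift (h2_const D)) = mult_op \<Theta>' (M_pencil E' B' (h2_const (U h)))"
      using B(2)[OF const[OF h]] B'(2)[OF const'[OF UE[OF h]]] U[OF h] pencil by simp
    ultimately have "h2_const (U (B h)) + shift (h2_const (U D)) = M_pencil E' B' (h2_const (U h))"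
      by (intro inj_onD[OF inj_on_mult_op[OF R'(1-3)]])
        (simp_all add: M_pencil_in_H2[OF R'(1,2) B'(1)] UE const' h BD shift_in_H2[OF R'(2)]
          csubspaceD(2)[OF csubspace_H2[OF R'(2)]])
    then have "h2_coeff (h2_const (U (B h)) + shift (h2_const (U D))) 0 = h2_coeff (M_pencil E' B' (h2_const (U h))) 0"
      by simp
    then show ?thesis by (simp add: h2_coeff_M_pencil[OF R'(1,2) B'(1)] const' UE h)
  qed
  ultimately show ?thesis by auto
qed

section \<open>Embedding a separable space into the sequence space\<close>

text \<open>
  Gram-Schmidt without discarding dependent vectors: these yield zero, so the entries are orthogonal
  with norm zero or one.
\<close>

fun gram_schmidt :: "(nat \<Rightarrow> 'a::complex_inner) \<Rightarrow> nat \<Rightarrow> 'a"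
  where "gram_schmidt d n =
    sgn (d n - (\<Sum>k<n. cinner (d n) (gram_schmidt d k) *\<^sub>C gram_schmidt d k))"

declare gram_schmidt.simps [simp del]

lemma norm_gram_schmidt: "gram_schmidt d n = 0 \<or> norm (gram_schmidt d n) = 1"
  by (subst (1 2) gram_schmidt.simps) (simp add: norm_sgn sgn_zero_iff)

lemma cinner_gram_schmidt_self:
  "cinner x (gram_schmidt d n) * cinner (gram_schmidt d n) (gram_schmidt d n) = cinner x (gram_schmidt d n)"
  using norm_gram_schmidt[of d n] by (auto simp: cinner_self)

text \<open>
  The second hypothesis holds both for unit vectors \<open>e k\<close> and for vanishing ones.
\<close>

lemma cinner_sum_orthogonal:
  fixes e :: "nat \<Rightarrow> 'a::complex_inner"
  assumes orth: "\<And>j k. j < n \<Longrightarrow> k < n \<Longrightarrow> j \<noteq> k \<Longrightarrow> cinner (e j) (e k) = 0"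
    and self: "\<And>k. k < n \<Longrightarrow> cinner x (e k) * cinner (e k) (e k) = cinner x (e k)"
    and k: "k < n"
  shows "cinner (x - (\<Sum>j<n. cinner x (e j) *\<^sub>C e j)) (e k) = 0"
proof -
  have "(\<Sum>j<n. cinner x (e j) * cinner (e j) (e k)) = (\<Sum>j<n. if j = k then cinner x (e k) else 0)"
    by (rule sum.cong) (auto simp: orth k self)
  then show ?thesis
    by (simp add: cinner_diff_left cinner_sum_left cinner_scaleC_left k)
qed

lemma gram_schmidt_orthogonal:
  "k < n \<Longrightarrow> cinner (gram_schmidt d n) (gram_schmidt d k) = 0"
proof (induction n arbitrary: k rule: less_induct)
  case (less n)
  have "cinner (gram_schmidt d i) (gram_schmidt d j) = 0" if "i < n" "j < n" "i \<noteq> j" for i j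
    using less.IH[of i j] less.IH[of j i] that by (metis cinner_eq_zero_commute linorder_neqE_nat)
  then have "cinner (d n - (\<Sum>j<n. cinner (d n) (gram_schmidt d j) *\<^sub>C gram_schmidt d j)) (gram_schmidt d k) = 0"
    by (intro cinner_sum_orthogonal less.prems cinner_gram_schmidt_self)
  then show ?case
    by (subst gram_schmidt.simps) (simp add: sgn_div_norm cinner_scaleR_left)
qed

text \<open>
  The embedding lists the inner products with the vectors obtained from a dense sequence \<open>d\<close>.  Its
  isometry is Parseval's identity: the distance of \<open>x\<close> from the span of the first \<open>N > n\<close> vectors is
  at most its distance from \<open>d n\<close>.
\<close>

lemma isometric_embedding_into_ell2:
  "\<exists>J :: 'a::{complex_inner,second_countable_topology} \<Rightarrow> ell2.
    (\<forall>x y. J (x + y) = J x + J y) \<and> (\<forall>a x. J (a *\<^sub>C x) = a *\<^sub>C J x) \<and> (\<forall>x. norm (J x) = norm x)"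
proof -
  obtain D :: "'a set" where D: "countable D" "\<And>U. open U \<Longrightarrow> U \<noteq> {} \<Longrightarrow> \<exists>d\<in>D. d \<in> U"
    using countable_dense_exists by auto
  have "D \<noteq> {}" using D(2)[of UNIV] by auto
  then obtain d :: "nat \<Rightarrow> 'a" where d: "range d = D"
    using range_from_nat_into[OF _ D(1)] by metis
  define e where "e = gram_schmidt d"
  define P where "P N x = (\<Sum>k<N. cinner x (e k) *\<^sub>C e k)" for N x
  have orth: "cinner (e i) (e j) = 0" if "i \<noteq> j" for i j
    unfolding e_def using that gram_schmidt_orthogonal[of i j d] gram_schmidt_orthogonal[of j i d]
    by (metis cinner_eq_zero_commute linorder_neqE_nat)
  have resid: "cinner (x - P N x) (e k) = 0" if "k < N" for x N k
    unfolding P_def by (rule cinner_sum_orthogonal[OF _ _ that]) (simp_all add: orth cinner_gram_schmidt_self[of x d, folded e_def])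
  have residP: "cinner (x - P N x) (P N y) = 0" for x y N
    unfolding P_def[of N y] cinner_sum_right by (rule sum.neutral) (simp add: cinner_scaleC_right resid)
  have normP: "(norm (P N x))\<^sup>2 = (\<Sum>k<N. (cmod (cinner x (e k)))\<^sup>2)" for N x
  proof -
    have "complex_of_real ((norm (P N x))\<^sup>2) = cinner x (P N x)"
      using residP[of x N x] cinner_self[of "P N x"] by (simp add: cinner_diff_left)
    also have "\<dots> = (\<Sum>k<N. cnj (cinner x (e k)) * cinner x (e k))"
      by (simp add: P_def cinner_sum_right cinner_scaleC_right)
    also have "\<dots> = complex_of_real (\<Sum>k<N. (cmod (cinner x (e k)))\<^sup>2)"
      by (simp add: complex_norm_square[symmetric] mult.commute[of "cnj _"] del: of_real_power)
    finally show ?thesis by (simp only: of_real_eq_iff)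
  qed
  have pyth: "(norm x)\<^sup>2 = (norm (x - P N x))\<^sup>2 + (norm (P N x))\<^sup>2" for x N
    using norm_add_orthogonal[OF residP[of x N x]] by simp
  (* d n lies in the span of the first n + 1 vectors: its component v orthogonal to the first n
     of them is a multiple of the last one *)
  have dP: "P N (d n) = d n" if "n < N" for n N
  proof -
    define v where "v = d n - P n (d n)"
    have "e n = sgn v" unfolding e_def v_def P_def by (rule gram_schmidt.simps)
    then have ve: "v = norm v *\<^sub>R e n" by (cases "v = 0") (simp_all add: sgn_div_norm)
    have "cinner (d n - P N (d n)) (d n - P N (d n)) = 0"
    proof -
      have "cinner (d n - P N (d n)) (P n (d n)) = 0"
        unfolding P_def[of n] cinner_sum_right using that
        by (intro sum.neutral) (simp add: cinner_scaleC_right resid)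
      moreover have "cinner (d n - P N (d n)) v = 0"
        by (subst ve) (simp add: cinner_scaleR_right resid that)
      ultimately have "cinner (d n - P N (d n)) (d n) = 0"
        by (simp add: v_def cinner_diff_right)
      then show ?thesis by (simp add: cinner_diff_right residP)
    qed
    then show ?thesis by simp
  qed
  have Pdiff: "P N (x - y) = P N x - P N y" for N x y
    by (simp add: P_def cinner_diff_left complex_vector.scale_left_diff_distrib sum_subtractf)
  have parseval: "(\<lambda>k. (cmod (cinner x (e k)))\<^sup>2) sums (norm x)\<^sup>2" for x
  proof -
    have "(\<lambda>N. norm (x - P N x)) \<longlonglongrightarrow> 0"
    proof (rule metric_LIMSEQ_I)
      fix r :: real assume "r > 0"
      then obtain n where n: "dist x (d n) < r"
        using D(2)[of "ball x r"] d by (auto simp: image_iff)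
      have "norm (x - P N x) < r" if "N \<ge> Suc n" for N
      proof -
        define y where "y = x - d n"
        have "y - P N y = x - P N x" using dP[of n N] that by (simp add: y_def Pdiff)
        then have "(norm (x - P N x))\<^sup>2 \<le> (norm y)\<^sup>2" using pyth[of y N] by simp
        then have "norm (x - P N x) \<le> norm y" by (rule power2_le_imp_le) simp
        then show ?thesis using n by (simp add: y_def dist_norm)
      qed
      then show "\<exists>M. \<forall>N\<ge>M. dist (norm (x - P N x)) 0 < r" by auto
    qed
    then have "(\<lambda>N. (norm x)\<^sup>2 - (norm (x - P N x))\<^sup>2) \<longlonglongrightarrow> (norm x)\<^sup>2 - 0\<^sup>2"
      by (intro tendsto_intros)
    moreover have "(norm x)\<^sup>2 - (norm (x - P N x))\<^sup>2 = (\<Sum>k<N. (cmod (cinner x (e k)))\<^sup>2)" for N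
      using pyth[of x N] normP[of N x] by simp
    ultimately show ?thesis by (simp add: sums_def)
  qed
  define J :: "'a \<Rightarrow> ell2" where "J x = Abs_h2 (\<lambda>k. cinner x (e k))" for x
  have J: "h2_coeff (J x) k = cinner x (e k)" for x k
    unfolding J_def by (rule h2_coeff_Abs_h2) (rule sums_summable[OF parseval])
  have "J (x + y) = J x + J y" for x y by (rule h2_eqI) (simp add: J cinner_add_left)
  moreover have "J (a *\<^sub>C x) = a *\<^sub>C J x" for a x
    by (rule h2_eqI) (simp add: J cinner_scaleC_left scaleC_complex_def)
  moreover have "norm (J x) = norm x" for x
  proof -
    have "(norm (J x))\<^sup>2 = (norm x)\<^sup>2"
      using h2_norm_sums[of "J x"] parseval[of x] unfolding J by (rule sums_unique2)
    then show ?thesis by simp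
  qed
  ultimately show ?thesis by blast
qed

section \<open>The Beurling-Lax-Halmos representation\<close>

lemma holomorphic_h2_eval:
  fixes g :: "'a::{complex_inner,complete_space} h2"
  shows "(\<lambda>z. cinner (h2_eval g z) k) holomorphic_on ball 0 1"
proof -
  define a where "a n = cinner (h2_coeff g n) k" for n
  have a: "(\<lambda>n. a n * z ^ n) sums cinner (h2_eval g z) k" if "cmod z < 1" for z
    using bounded_linear.sums[OF bounded_linear_cinner_left h2_eval_sums[OF that, of g], of k]
    by (simp add: a_def cinner_scaleC_left mult.commute)
  have "(\<lambda>z. \<Sum>n. a n * z ^ n) field_differentiable at z" if z: "cmod z < 1" for z
  proof -
    obtain r where r: "cmod z < r" "r < 1" using dense[OF z] by blast
    moreover from r have "r > 0" using norm_ge_zero[of z] by linarith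
    ultimately have r': "cmod (of_real r) < 1" "cmod z < cmod (of_real r)" by simp_all
    show ?thesis
      unfolding field_differentiable_def
      using termdiffs_strong[OF sums_summable[OF a[OF r'(1)]] r'(2)] by blast
  qed
  then have "(\<lambda>z. \<Sum>n. a n * z ^ n) holomorphic_on ball 0 1"
    by - (rule holomorphic_onI, rule field_differentiable_at_within, simp)
  then show ?thesis
    by (rule holomorphic_transform) (use a in \<open>simp add: sums_iff\<close>)
qed

text \<open>The orthogonal complement of \<open>z S\<close> in \<open>S\<close>.\<close>

definition wandering :: "'a::complex_inner h2 set \<Rightarrow> 'a h2 set"
  where "wandering S = {w\<in>S. \<forall>s\<in>S. cinner w (shift s) = 0}"

lemma csubspace_wandering: "csubspace S \<Longrightarrow> csubspace (wandering S)"
  unfolding complex_vector.subspace_def wandering_def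
  by (auto simp: cinner_add_left cinner_scaleC_left)

lemma closed_wandering:
  assumes "closed S"
  shows "closed (wandering S)"
proof -
  have "closed {w. cinner w (shift s) = 0}" for s :: "'a h2"
  proof -
    have "continuous_on UNIV (\<lambda>w. cinner w (shift s))"
      by (rule linear_continuous_on[OF bounded_linear_cinner_left])
    then show ?thesis using closed_Collect_eq[OF _ continuous_on_const] by metis
  qed
  then have "closed (S \<inter> (\<Inter>s\<in>S. {w. cinner w (shift s) = 0}))"
    using assms by (simp add: closed_Int closed_INT)
  moreover have "S \<inter> (\<Inter>s\<in>S. {w. cinner w (shift s) = 0}) = wandering S"
    by (auto simp: wandering_def)
  ultimately show ?thesis by simp
qed

lemma wandering_decomposition:
  fixes S :: "'a::{complex_inner,complete_space} h2 set"
  assumes S: "closed S" "csubspace S" and inv: "shift ` S \<subseteq> S" and f: "f \<in> S"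
  shows "\<exists>w\<in>wandering S. \<exists>g\<in>S. f = w + shift g"
proof -
  have "closed (shift ` S)"
    by (rule closed_isometric_image[OF S(2,1)]) (simp_all add: shift_diff)
  moreover have "csubspace (shift ` S)"
    unfolding complex_vector.subspace_def
    by (auto simp: shift_add[symmetric] shift_scaleC[symmetric] csubspaceD[OF S(2)]
        intro!: image_eqI[of 0 shift 0])
  ultimately obtain p where p: "p \<in> shift ` S" "\<And>y. y \<in> shift ` S \<Longrightarrow> cinner (f - p) y = 0"
    using orthogonal_projection[of "shift ` S" f] by blast
  then have "f - p \<in> wandering S"
    using inv f csubspaceD(4)[OF S(2)] by (auto simp: wandering_def)
  moreover obtain g where "g \<in> S" "p = shift g" using p(1) by blast
  ultimately show ?thesis by (intro bexI[of _ "f - p"] bexI[of _ g]) simp_all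
qed

lemma wandering_orthogonal:
  assumes inv: "shift ` S \<subseteq> S" and uv: "u \<in> wandering S" "v \<in> S" and "m < n"
  shows "cinner ((shift ^^ m) u) ((shift ^^ n) v) = 0"
proof -
  obtain k where k: "n = m + Suc k" using less_imp_Suc_add[OF \<open>m < n\<close>] by auto
  have "(shift ^^ k) v \<in> S" using uv(2) inv by (induction k) auto
  moreover have "(shift ^^ n) v = (shift ^^ m) (shift ((shift ^^ k) v))"
    unfolding k funpow_add by simp
  ultimately show ?thesis using uv(1) by (simp add: wandering_def)
qed

text \<open>
  Every \<open>f \<in> S\<close> is expanded as \<open>w\<^sub>0 + z w\<^sub>1 + \<dots> + z\<^sup>n f\<^sub>n\<close> with \<open>w\<^sub>k\<close> wandering and \<open>f\<^sub>n \<in> S\<close>.  The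
  remainder has no influence on the first \<open>n\<close> coefficients, so no limit of it is required.
\<close>

lemma wandering_expansion:
  fixes S :: "'a::{complex_inner,complete_space} h2 set"
  assumes S: "closed S" "csubspace S" and inv: "shift ` S \<subseteq> S" and f: "f \<in> S"
  shows "\<exists>w. (\<forall>n. w n \<in> wandering S) \<and> summable (\<lambda>n. (norm (w n))\<^sup>2) \<and>
    (\<lambda>n. (shift ^^ n) (w n)) sums f"
proof -
  have "\<forall>f\<in>S. \<exists>w g. w \<in> wandering S \<and> g \<in> S \<and> f = w + shift g"
    using wandering_decomposition[OF S inv] by blast
  then obtain W G where WG: "\<And>f. f \<in> S \<Longrightarrow> W f \<in> wandering S" "\<And>f. f \<in> S \<Longrightarrow> G f \<in> S"
    "\<And>f. f \<in> S \<Longrightarrow> f = W f + shift (G f)" by metis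
  define F where "F n = (G ^^ n) f" for n
  define w where "w n = W (F n)" for n
  have F: "F n \<in> S" for n by (induction n) (simp_all add: F_def f WG(2))
  have w: "w n \<in> wandering S" for n by (simp add: w_def WG(1) F)
  have step: "F n = w n + shift (F (Suc n))" for n
    using WG(3)[OF F[of n]] by (simp add: w_def F_def)
  have expand: "f = (\<Sum>k<n. (shift ^^ k) (w k)) + (shift ^^ n) (F n)" for n
  proof (induction n)
    case (Suc n)
    have "(shift ^^ n) (F n) = (shift ^^ n) (w n) + (shift ^^ Suc n) (F (Suc n))"
      by (subst step) (simp add: shift_power_add funpow_swap1)
    then show ?case using Suc by (simp add: add.assoc)
  qed (simp add: F_def)
  have norm_step: "(norm (F n))\<^sup>2 = (norm (w n))\<^sup>2 + (norm (F (Suc n)))\<^sup>2" for n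
    using norm_add_orthogonal[of "w n" "shift (F (Suc n))"] w[of n] F[of "Suc n"] step[of n]
    by (simp add: wandering_def)
  have "(\<Sum>k<n. (norm (w k))\<^sup>2) = (norm f)\<^sup>2 - (norm (F n))\<^sup>2" for n
  proof (induction n)
    case (Suc n)
    then show ?case using norm_step[of n] by simp
  qed (simp add: F_def)
  then have partial: "(\<Sum>k<n. (norm (w k))\<^sup>2) \<le> (norm f)\<^sup>2" for n by simp
  have sm: "summable (\<lambda>n. (norm (w n))\<^sup>2)"
    by (rule h2_norm_leI(1)[of "norm f"]) (simp_all add: partial)
  have "summable (\<lambda>n. (shift ^^ n) (w n))"
    by (rule orthogonal_series(1))
      (use wandering_orthogonal[OF inv] w sm in \<open>auto simp: wandering_def\<close>)
  then obtain s where s: "(\<lambda>n. (shift ^^ n) (w n)) sums s" by (auto simp: summable_def)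
  have "h2_coeff s m = h2_coeff f m" for m
  proof -
    have "(\<lambda>n. h2_coeff ((shift ^^ n) (w n)) m) sums h2_coeff s m"
      by (rule bounded_linear.sums[OF bounded_linear_h2_coeff s])
    moreover have "(\<lambda>n. h2_coeff ((shift ^^ n) (w n)) m) sums (\<Sum>n<Suc m. h2_coeff ((shift ^^ n) (w n)) m)"
      by (rule sums_finite) (auto simp: h2_coeff_shift_power)
    ultimately have "h2_coeff s m = (\<Sum>n<Suc m. h2_coeff ((shift ^^ n) (w n)) m)"
      using sums_unique2 by blast
    also have "\<dots> = h2_coeff (\<Sum>n<Suc m. (shift ^^ n) (w n)) m"
      by (rule linear_sum[OF bounded_linear.linear[OF bounded_linear_h2_coeff], symmetric])
    also have "\<dots> = h2_coeff f m"
      using arg_cong[OF expand[of "Suc m"], of "\<lambda>f. h2_coeff f m"]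
      by (simp add: h2_coeff_shift_power del: funpow.simps sum.lessThan_Suc)
    finally show ?thesis .
  qed
  then have "s = f" by (rule h2_eqI)
  then show ?thesis using w sm s by blast
qed

text \<open>
  With \<open>E\<close> an isometric copy of the wandering subspace in \<open>\<ell>\<^sup>2\<close> and \<open>R\<close> the inverse isometry, \<open>\<Theta>\<close>
  sends \<open>e\<close> to the value of \<open>R e\<close> at \<open>z\<close>, and multiplication by \<open>\<Theta>\<close> is \<open>f \<mapsto> \<Sum> z\<^sup>n R f\<^sub>n\<close>, an
  orthogonal series.  Evaluating it on the reproducing kernel at \<open>z\<close> bounds \<open>\<Theta> z\<close> by one.
\<close>

lemma BLH_representation_exists:
  fixes S :: "'h::{complex_inner,polish_space} h2 set"
  assumes S: "closed S" "csubspace S" and inv: "shift ` S \<subseteq> S"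
  shows "\<exists>(E :: ell2 set) \<Theta>. BLH_representation S E \<Theta>"
proof -
  define W where "W = wandering S"
  have W: "csubspace W" "closed W" by (simp_all add: W_def csubspace_wandering S closed_wandering)
  have WS: "W \<subseteq> S" by (auto simp: W_def wandering_def)
  obtain J :: "'h h2 \<Rightarrow> ell2" where J: "\<And>x y. J (x + y) = J x + J y"
    "\<And>a x. J (a *\<^sub>C x) = a *\<^sub>C J x" "\<And>x. norm (J x) = norm x"
    using isometric_embedding_into_ell2[where 'a = "'h h2"] by blast
  have Jdiff: "J (x - y) = J x - J y" for x y using J(1)[of "x - y" y] by simp
  have Jinj: "J x = J y \<Longrightarrow> x = y" for x y using Jdiff[of x y] J(3)[of "x - y"] by simp
  define E where "E = J ` W"
  define R where "R = inv_into W J"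
  have RW: "R e \<in> W" "J (R e) = e" if "e \<in> E" for e
    using that unfolding E_def R_def by (simp_all add: inv_into_into f_inv_into_f)
  have RJ: "R (J w) = w" if "w \<in> W" for w
    using RW[of "J w"] that Jinj by (simp add: E_def)
  have E: "closed E" "csubspace E"
  proof -
    show "closed E" unfolding E_def by (rule closed_isometric_image[OF W]) (simp_all add: Jdiff J)
    have "0 = J 0" using J(3)[of 0] by simp
    then show "csubspace E"
      unfolding complex_vector.subspace_def E_def
      by (auto simp: J(1,2)[symmetric] csubspaceD[OF W(1)] intro!: image_eqI[of 0 J 0])
  qed
  note sub = csubspaceD[OF E(2)]
  have Radd: "R (x + y) = R x + R y" if "x \<in> E" "y \<in> E" for x y
    by (rule Jinj) (simp add: J RW sub that)
  have Rscale: "R (a *\<^sub>C x) = a *\<^sub>C R x" if "x \<in> E" for a x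
    by (rule Jinj) (simp add: J RW sub that)
  have Rnorm: "norm (R x) = norm x" if "x \<in> E" for x
    using J(3)[of "R x"] RW[OF that] by simp
  define \<Theta> where "\<Theta> z e = h2_eval (R e) z" for z e
  define V where "V f = (\<Sum>n. (shift ^^ n) (R (h2_coeff f n)))" for f
  have V: "(\<lambda>n. (shift ^^ n) (R (h2_coeff f n))) sums V f" "norm (V f) = norm f" if f: "f \<in> H2 E" for f
  proof -
    have orth: "cinner ((shift ^^ m) (R (h2_coeff f m))) ((shift ^^ n) (R (h2_coeff f n))) = 0"
      if "m < n" for m n
      using wandering_orthogonal[OF inv _ _ that] RW(1)[OF H2_coeff[OF f]] WS unfolding W_def by blast
    have eq: "(\<lambda>n. (norm ((shift ^^ n) (R (h2_coeff f n))))\<^sup>2) = (\<lambda>n. (norm (h2_coeff f n))\<^sup>2)"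
      by (simp add: Rnorm H2_coeff[OF f])
    have sm: "summable (\<lambda>n. (norm ((shift ^^ n) (R (h2_coeff f n))))\<^sup>2)"
      unfolding eq by (rule h2_coeff_summable)
    show "(\<lambda>n. (shift ^^ n) (R (h2_coeff f n))) sums V f"
      unfolding V_def by (rule summable_sums[OF orthogonal_series(1)[OF orth sm]])
    have "(norm (V f))\<^sup>2 = (norm f)\<^sup>2"
      using orthogonal_series(2)[OF orth sm] h2_norm_sums[of f]
      unfolding V_def eq by (simp add: sums_iff)
    then show "norm (V f) = norm f" by simp
  qed
  have \<Theta>op: "bounded_op E UNIV (\<Theta> z)" if z: "cmod z < 1" for z
  proof -
    obtain K where K: "\<And>g :: 'h h2. norm (h2_eval g z) \<le> norm g * K"
      using bounded_linear.bounded[OF bounded_linear_h2_eval[OF z]] by blast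
    have "norm (\<Theta> z x) \<le> K * norm x" if "x \<in> E" for x
      using K[of "R x"] Rnorm[OF that] by (simp add: \<Theta>_def mult.commute)
    then show ?thesis
      unfolding bounded_op_def by (auto simp: \<Theta>_def Radd Rscale h2_eval_add[OF z] h2_eval_scaleC[OF z])
  qed
  have evalV: "h2_eval (V f) z = \<Theta> z (h2_eval f z)" if f: "f \<in> H2 E" and z: "cmod z < 1" for f z
  proof -
    have "(\<lambda>n. h2_eval ((shift ^^ n) (R (h2_coeff f n))) z) sums h2_eval (V f) z"
      by (rule bounded_linear.sums[OF bounded_linear_h2_eval[OF z] V(1)[OF f]])
    moreover have "(\<lambda>n. \<Theta> z (z ^ n *\<^sub>C h2_coeff f n)) sums \<Theta> z (h2_eval f z)"
      by (rule bounded_op_sums(1)[OF \<Theta>op[OF z] E _ h2_eval_sums[OF z]]) (intro sub H2_coeff[OF f])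
    moreover have "\<Theta> z (z ^ n *\<^sub>C h2_coeff f n) = h2_eval ((shift ^^ n) (R (h2_coeff f n))) z" for n
      by (simp add: \<Theta>_def Rscale H2_coeff[OF f] h2_eval_shift_power[OF z] h2_eval_scaleC[OF z])
    ultimately show ?thesis by (simp add: sums_unique2)
  qed
  have multV: "mult_op \<Theta> f = V f" if "f \<in> H2 E" for f
    by (rule mult_op_eqI) (rule evalV[OF that])
  have bound: "norm (\<Theta> z h) \<le> norm h" if z: "cmod z < 1" and h: "h \<in> E" for z h
  proof -
    define c where "c = 1 / (1 - (cmod z)\<^sup>2)"
    have c: "c > 0" using cmod_power2_less_1[OF z] by (simp add: c_def)
    have k: "szego_kernel z h \<in> H2 E"
      by (simp add: H2_def h2_coeff_szego_kernel[OF z] sub h)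
    have "h2_eval (V (szego_kernel z h)) z = complex_of_real c *\<^sub>C \<Theta> z h"
      unfolding evalV[OF k z] h2_eval_szego_kernel[OF z] c_def[symmetric]
      by (rule bounded_opD(3)[OF \<Theta>op[OF z] h])
    then have "(norm (complex_of_real c *\<^sub>C \<Theta> z h))\<^sup>2 \<le> (norm (szego_kernel z h))\<^sup>2 / (1 - (cmod z)\<^sup>2)"
      using norm_h2_eval_le[OF z, of "V (szego_kernel z h)"] by (simp only: V(2)[OF k])
    moreover have "norm (complex_of_real c *\<^sub>C \<Theta> z h) = c * norm (\<Theta> z h)"
      using c by (simp add: norm_scaleC)
    ultimately have "(c * norm (\<Theta> z h))\<^sup>2 \<le> (norm (szego_kernel z h))\<^sup>2 / (1 - (cmod z)\<^sup>2)"
      by simp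
    also have "\<dots> = (c * norm h)\<^sup>2"
      unfolding h2_coeff_szego_kernel(2)[OF z] by (simp add: c_def power2_eq_square)
    finally have "c * norm (\<Theta> z h) \<le> c * norm h"
      using c by (simp add: power2_le_iff_abs_le abs_mult)
    then show ?thesis using c by simp
  qed
  have "\<Theta> \<in> H_infty E UNIV"
    unfolding H_infty_def using \<Theta>op bound holomorphic_h2_eval
    by (auto simp: \<Theta>_def intro!: exI[of _ 1])
  then have "inner_function E UNIV \<Theta>"
    unfolding inner_function_def using multV V(2) by simp
  moreover have "S = mult_op \<Theta> ` H2 E"
  proof (intro equalityI subsetI)
    fix f assume "f \<in> S"
    then obtain w where w: "\<And>n. w n \<in> W" "summable (\<lambda>n. (norm (w n))\<^sup>2)"
      "(\<lambda>n. (shift ^^ n) (w n)) sums f"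
      using wandering_expansion[OF S inv] unfolding W_def by blast
    define g where "g = Abs_h2 (\<lambda>n. J (w n))"
    have g: "h2_coeff g n = J (w n)" for n
      unfolding g_def by (rule h2_coeff_Abs_h2) (simp add: J w(2))
    have gE: "g \<in> H2 E" by (simp add: H2_def g E_def w(1))
    have "V g = f" using V(1)[OF gE] w(3) by (simp add: g RJ w(1) sums_unique2)
    then show "f \<in> mult_op \<Theta> ` H2 E" using multV[OF gE] gE by (metis imageI)
  next
    fix f assume "f \<in> mult_op \<Theta> ` H2 E"
    then obtain g where g: "g \<in> H2 E" "f = V g" using multV by auto
    have inS: "(shift ^^ n) s \<in> S" if "s \<in> S" for n s
      using that inv by (induction n) auto
    have "(\<lambda>N. \<Sum>n<N. (shift ^^ n) (R (h2_coeff g n))) \<longlonglongrightarrow> f"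
      using V(1)[OF g(1)] g(2) by (simp add: sums_def)
    moreover have "(\<Sum>n<N. (shift ^^ n) (R (h2_coeff g n))) \<in> S" for N
      using RW(1)[OF H2_coeff[OF g(1)]] WS by (intro csubspaceD(7)[OF S(2)] inS) auto
    ultimately show "f \<in> S" using closed_sequentially[OF S(1), of "\<lambda>N. \<Sum>n<N. (shift ^^ n) (R (h2_coeff g n))"] by simp
  qed
  ultimately show ?thesis unfolding BLH_representation_def using E by blast
qed

section \<open>Joint invariance\<close>

theorem theorem3p3:
  fixes A :: "'h \<Rightarrow> 'h::{complex_inner,polish_space}"
    and S :: "'h h2 set"
  assumes "bounded_op UNIV UNIV A" and "numerical_radius UNIV A \<le> 1"
    and "closed S" and "csubspace S" and "S \<noteq> {0}"
  shows
    "((M_pencil UNIV A ` S \<subseteq> S \<and> M_z ` S \<subseteq> S) \<longleftrightarrow>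
        (\<exists>(E :: ell2 set) \<Theta>. BLH_representation S E \<Theta> \<and> (\<exists>B. intertwines A E \<Theta> B)))
   \<and> (\<forall>(E :: 'e::{complex_inner,polish_space} set) \<Theta>. BLH_representation S E \<Theta> \<longrightarrow>
        ((M_pencil UNIV A ` S \<subseteq> S \<and> M_z ` S \<subseteq> S) \<longleftrightarrow> (\<exists>B. intertwines A E \<Theta> B)))
   \<and> (\<forall>(E :: 'e set) \<Theta> B (E' :: 'e'::{complex_inner,polish_space} set) \<Theta>' B'.
        BLH_representation S E \<Theta> \<and> intertwines A E \<Theta> B \<and>
        BLH_representation S E' \<Theta>' \<and> intertwines A E' \<Theta>' B' \<longrightarrow>
        (\<exists>U. unitary_op E E' U \<and>
             (\<forall>z\<in>ball 0 1. \<forall>h\<in>E. \<Theta> z h = \<Theta>' z (U h)) \<and>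
             (\<forall>h\<in>E. U (B h) = B' (U h))))"
proof (intro conjI allI impI)
  show "(M_pencil UNIV A ` S \<subseteq> S \<and> M_z ` S \<subseteq> S) \<longleftrightarrow>
      (\<exists>(E :: ell2 set) \<Theta>. BLH_representation S E \<Theta> \<and> (\<exists>B. intertwines A E \<Theta> B))"
  proof
    assume inv: "M_pencil UNIV A ` S \<subseteq> S \<and> M_z ` S \<subseteq> S"
    then obtain E :: "ell2 set" and \<Theta> where R: "BLH_representation S E \<Theta>"
      using BLH_representation_exists[OF assms(3,4)] by (auto simp: M_z_eq_shift)
    then show "\<exists>(E :: ell2 set) \<Theta>. BLH_representation S E \<Theta> \<and> (\<exists>B. intertwines A E \<Theta> B)"
      using intertwines_if_invariant[OF assms(1,2) R] inv by blast
  next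
    assume "\<exists>(E :: ell2 set) \<Theta>. BLH_representation S E \<Theta> \<and> (\<exists>B. intertwines A E \<Theta> B)"
    then obtain E :: "ell2 set" and \<Theta> B
      where "BLH_representation S E \<Theta>" "intertwines A E \<Theta> B" by blast
    then show "M_pencil UNIV A ` S \<subseteq> S \<and> M_z ` S \<subseteq> S"
      by (intro conjI invariant_if_intertwines)
  qed
next
  fix E :: "'e set" and \<Theta> :: "complex \<Rightarrow> 'e \<Rightarrow> 'h"
  assume R: "BLH_representation S E \<Theta>"
  show "(M_pencil UNIV A ` S \<subseteq> S \<and> M_z ` S \<subseteq> S) \<longleftrightarrow> (\<exists>B. intertwines A E \<Theta> B)"
    using intertwines_if_invariant[OF assms(1,2) R] invariant_if_intertwines[OF R] by blast
next
  fix E :: "'e set" and \<Theta> B and E' :: "'e' set" and \<Theta>' B'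
  assume "BLH_representation S E \<Theta> \<and> intertwines A E \<Theta> B \<and>
    BLH_representation S E' \<Theta>' \<and> intertwines A E' \<Theta>' B'"
  then show "\<exists>U. unitary_op E E' U \<and> (\<forall>z\<in>ball 0 1. \<forall>h\<in>E. \<Theta> z h = \<Theta>' z (U h)) \<and>
      (\<forall>h\<in>E. U (B h) = B' (U h))"
    using intertwined_operator_unique[of S E \<Theta> E' \<Theta>' A B B'] by simp
qed

end
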